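(* Let $z\in[0,1]$ be a Martin-Löf random real. Then $z$ does not Turing compute $\emptyset'$ if and only if $z$ is a positive density point.
   Context: Reals are identified with their binary expansions. Martin-Löf randomness: $z$ avoids $\bigcap_nU_n$ for every uniformly c.e. sequence of open classes $(U_n)$ with $\lambda(U_n)\le2^{-n}$. A class $\mathcal{C}\subseteq[0,1]$ is effectively closed if its complement is the union of an effective sequence of open intervals with rational endpoints. The lower Lebesgue density of $\mathcal{C}$ at $z$ is $\varrho(\mathcal{C}\mid z)=\liminf_{\gamma,\delta\to0^+}\frac{\lambda([z-\gamma,z+\delta]\cap\mathcal{C})}{\gamma+\delta}$. $z$ is a positive density point if $\varrho(\mathcal{C}\mid z)>0$ for every effectively closed class $\mathcal{C}$ containing $z$. *)

theory Defs
  imports "HOL-Analysis.Analysis" "HOL-Library.Nat_Bijection" "HOL-Library.Countable"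
    "HOL-Library.Liminf_Limsup"
begin

section \<open>Relativized partial recursive functions\<close>

text \<open>
  Programs for the partial recursive functions relative to a set. All functions are unary; several
  arguments are passed as one number via the pairing bijection \<open>prod_encode\<close>. \<open>Query\<close> asks the
  auxiliary set. The identity is \<open>PairOf Fst Snd\<close>.
\<close>

datatype program =
    Zero
  | Succ
  | Fst
  | Snd
  | Query
  | PairOf program program
  | Comp program program
  | PrimRec program program
  | Mu program

text \<open>\<open>runs A p x y\<close>: program \<open>p\<close> on input \<open>x\<close> with auxiliary set \<open>A\<close> halts with output \<open>y\<close>.\<close>

inductive runs :: "nat set \<Rightarrow> program \<Rightarrow> nat \<Rightarrow> nat \<Rightarrow> bool" for A :: "nat set" where
  runs_Zero: "runs A Zero x 0"
| runs_Succ: "runs A Succ x (Suc x)"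
| runs_Fst: "runs A Fst x (fst (prod_decode x))"
| runs_Snd: "runs A Snd x (snd (prod_decode x))"
| runs_Query: "runs A Query x (of_bool (x \<in> A))"
| runs_PairOf: "runs A p x y \<Longrightarrow> runs A q x z \<Longrightarrow> runs A (PairOf p q) x (prod_encode (y, z))"
| runs_Comp: "runs A q x y \<Longrightarrow> runs A p y z \<Longrightarrow> runs A (Comp p q) x z"
| runs_PrimRec_0: "runs A p x y \<Longrightarrow> runs A (PrimRec p q) (prod_encode (x, 0)) y"
| runs_PrimRec_Suc:
    "runs A (PrimRec p q) (prod_encode (x, n)) y \<Longrightarrow>
     runs A q (prod_encode (x, prod_encode (n, y))) z \<Longrightarrow>
     runs A (PrimRec p q) (prod_encode (x, Suc n)) z"
| runs_Mu:
    "runs A p (prod_encode (x, n)) 0 \<Longrightarrow>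
     \<forall>m<n. \<exists>y. runs A p (prod_encode (x, m)) (Suc y) \<Longrightarrow>
     runs A (Mu p) x n"

definition computable :: "(nat \<Rightarrow> nat) \<Rightarrow> bool" where
  "computable f \<longleftrightarrow> (\<exists>p. \<forall>x. runs {} p x (f x))"

definition turing_computes :: "nat set \<Rightarrow> nat set \<Rightarrow> bool" where
  "turing_computes A B \<longleftrightarrow> (\<exists>p. \<forall>x. runs A p x (of_bool (x \<in> B)))"

text \<open>A Goedel numbering: a bijection between programs and natural numbers.\<close>

primrec program_encode :: "program \<Rightarrow> nat" where
  "program_encode Zero = 0"
| "program_encode Succ = 1"
| "program_encode Fst = 2"
| "program_encode Snd = 3"
| "program_encode Query = 4"
| "program_encode (PairOf p q) = 5 + 4 * prod_encode (program_encode p, program_encode q)"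
| "program_encode (Comp p q) = 6 + 4 * prod_encode (program_encode p, program_encode q)"
| "program_encode (PrimRec p q) = 7 + 4 * prod_encode (program_encode p, program_encode q)"
| "program_encode (Mu p) = 8 + 4 * program_encode p"

definition turing_jump :: "nat set \<Rightarrow> nat set" where
  "turing_jump A = {program_encode p |p. \<exists>y. runs A p (program_encode p) y}"


section \<open>Effective classes of reals in the unit interval\<close>

text \<open>
  The set of positions of the digit 1, where position \<open>n\<close> has weight \<open>2 powr -(n+1)\<close>. A dyadic
  rational gets its terminating expansion (and 1 gets the empty set, the fractional part of
  \<open>1.000...\<close>); such numbers are computable and never Martin-Loef random.
\<close>

definition binary_expansion :: "real \<Rightarrow> nat set" where
  "binary_expansion z = {n. odd \<lfloor>z * 2 ^ Suc n\<rfloor>}"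

text \<open>
  Open intervals with rational endpoints; the empty interval also has codes. The numbering
  \<open>nat_to_rat_surj\<close> of the rationals is an explicit (computable) one.
\<close>

definition rat_interval :: "nat \<Rightarrow> real set" where
  "rat_interval m = (let (a, b) = prod_decode m in
     {real_of_rat (nat_to_rat_surj a) <..< real_of_rat (nat_to_rat_surj b)})"

text \<open>
  Open means relatively open in the unit interval, so that classes containing the endpoints are
  included. As the empty interval has codes, computable sequences of codes generate the same
  classes as computably enumerable sets of codes.
\<close>

definition effectively_open :: "real set \<Rightarrow> bool" where
  "effectively_open V \<longleftrightarrow> (\<exists>f. computable f \<and> V = {0..1} \<inter> (\<Union>k. rat_interval (f k)))"

definition uniformly_effectively_open :: "(nat \<Rightarrow> real set) \<Rightarrow> bool" where
  "uniformly_effectively_open U \<longleftrightarrow>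
     (\<exists>f. computable f \<and> (\<forall>n. U n = {0..1} \<inter> (\<Union>k. rat_interval (f (prod_encode (n, k))))))"

definition effectively_closed :: "real set \<Rightarrow> bool" where
  "effectively_closed C \<longleftrightarrow> C \<subseteq> {0..1} \<and> effectively_open ({0..1} - C)"

text \<open>Meaningful for \<open>z\<close> in the unit interval only.\<close>

definition martin_loef_random :: "real \<Rightarrow> bool" where
  "martin_loef_random z \<longleftrightarrow>
     (\<forall>U. uniformly_effectively_open U \<and> (\<forall>n. measure lborel (U n) \<le> (1 / 2) ^ n) \<longrightarrow>
        z \<notin> (\<Inter>n. U n))"


section \<open>Lebesgue density\<close>

definition lower_density :: "real set \<Rightarrow> real \<Rightarrow> ereal" where
  "lower_density C z =
     Liminf (at_right 0 \<times>\<^sub>F at_right 0)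
       (\<lambda>(\<gamma>, \<delta>). ereal (measure lborel ({z - \<gamma>..z + \<delta>} \<inter> C) / (\<gamma> + \<delta>)))"

definition positive_density_point :: "real \<Rightarrow> bool" where
  "positive_density_point z \<longleftrightarrow>
     (\<forall>C. effectively_closed C \<and> z \<in> C \<longrightarrow> lower_density C z > 0)"

end

theory Submission imports Defs begin

text \<open>
  Everything is discretized to dyadic cells, and a Martin-Loef test becomes a decidable family of
  cells that is closed under refinement and has few members at each level.

  Suppose \<open>z\<close> computes the halting set through a program \<open>G\<close>. Each cell \<open>\<sigma>\<close> and each \<open>K\<close> get their own
  number \<open>p\<close>, whose membership in the halting set is under our control. As soon as the oracles in \<open>\<sigma>\<close> for which
  \<open>G\<close> denies membership of \<open>p\<close> fill more than the fraction \<open>1 - 2 powr -K\<close> of \<open>\<sigma>\<close>, we put \<open>p\<close> into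
  the halting set. Let \<open>C\<close> be the class of oracles on which \<open>G\<close> never errs in this way, so that
  \<open>z \<in> C\<close>. If \<open>C\<close> had density at least \<open>2 powr -K\<close> in all cells around \<open>z\<close>, then no number of such a
  cell would be put in; so \<open>G\<close> with oracle \<open>z\<close> denies all of them, and passing repeatedly from a
  cell to its subset of denying oracles yields a Martin-Loef test with measures
  \<open>(1 - 2 powr -K) ^ m\<close> that captures \<open>z\<close>.

  Conversely, let \<open>z \<in> C\<close> have lower density zero in \<open>C\<close>. With oracle \<open>z\<close>, search for a stage \<open>t\<close> at
  which some interval around \<open>z\<close> has density below \<open>2 powr -n\<close> in the stage \<open>t\<close> approximation of
  \<open>C\<close>. If \<open>n\<close> enters the halting set at a stage \<open>s \<ge> t\<close>, then \<open>z\<close> lies in the part of the stage \<open>s\<close>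
  approximation of \<open>C\<close> that is covered by such intervals, and this part has measure at most
  \<open>4 * 2 powr -n\<close>. By randomness this happens for finitely many \<open>n\<close> only, so for almost all \<open>n\<close> the
  stage \<open>t\<close> decides membership in the halting set.
\<close>

section \<open>Closure properties of oracle computability\<close>

definition computable_from :: "nat set \<Rightarrow> (nat \<Rightarrow> nat) \<Rightarrow> bool" where
  "computable_from A f \<longleftrightarrow> (\<exists>p. \<forall>x. runs A p x (f x))"

definition decidable_from :: "nat set \<Rightarrow> (nat \<Rightarrow> bool) \<Rightarrow> bool" where
  "decidable_from A P \<longleftrightarrow> computable_from A (\<lambda>x. of_bool (P x))"

abbreviation pr1 :: "nat \<Rightarrow> nat" where "pr1 u \<equiv> fst (prod_decode u)"
abbreviation pr2 :: "nat \<Rightarrow> nat" where "pr2 u \<equiv> snd (prod_decode u)"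

lemma runs_deterministic: "runs A p x y \<Longrightarrow> runs A p x y' \<Longrightarrow> y' = y"
proof (induction arbitrary: y' rule: runs.induct)
  case (runs_PairOf p x y q z)
  from runs_PairOf.prems show ?case by cases (use runs_PairOf.IH in auto)
next
  case (runs_Comp q x y p z)
  from runs_Comp.prems show ?case by cases (use runs_Comp.IH in auto)
next
  case (runs_PrimRec_0 p x y q)
  from runs_PrimRec_0.prems show ?case by cases (use runs_PrimRec_0.IH in auto)
next
  case (runs_PrimRec_Suc p q x n y z)
  from runs_PrimRec_Suc.prems show ?case by cases (use runs_PrimRec_Suc.IH in auto)
next
  case (runs_Mu p x n)
  from runs_Mu.prems show ?case
  proof cases
    case (runs_Mu)
    \<comment> \<open>If the two results differed, the program would output both 0 and a successor
      at the smaller one.\<close>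
    show ?thesis
      using runs_Mu runs_Mu.hyps
      by (metis nat.distinct(1) nat_neq_iff runs_Mu.IH(1) runs_Mu.IH(2))
  qed
qed (auto elim: runs.cases)


lemma computable_fromI: "(\<And>x. runs A p x (f x)) \<Longrightarrow> computable_from A f"
  by (auto simp: computable_from_def)

lemma computable_id: "computable_from A (\<lambda>x. x)"
proof (rule computable_fromI)
  show "runs A (PairOf Fst Snd) x x" for x
    using runs_PairOf[OF runs_Fst runs_Snd, of A x] by simp
qed

lemma computable_comp:
  assumes "computable_from A f" "computable_from A g"
  shows "computable_from A (\<lambda>x. f (g x))"
  using assms unfolding computable_from_def by (meson runs_Comp)

lemma computable_Suc:
  assumes "computable_from A f" shows "computable_from A (\<lambda>x. Suc (f x))"
  by (rule computable_comp[OF _ assms]) (rule computable_fromI[OF runs_Succ])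

lemma computable_const: "computable_from A (\<lambda>x. c)"
proof (induction c)
  case 0
  show ?case by (rule computable_fromI[OF runs_Zero])
qed (rule computable_Suc)

lemma computable_fst:
  assumes "computable_from A f" shows "computable_from A (\<lambda>x. pr1 (f x))"
  by (rule computable_comp[OF _ assms]) (rule computable_fromI[OF runs_Fst])

lemma computable_snd:
  assumes "computable_from A f" shows "computable_from A (\<lambda>x. pr2 (f x))"
  by (rule computable_comp[OF _ assms]) (rule computable_fromI[OF runs_Snd])

lemma computable_pair:
  assumes "computable_from A f" "computable_from A g"
  shows "computable_from A (\<lambda>x. prod_encode (f x, g x))"
  using assms unfolding computable_from_def by (meson runs_PairOf)

lemma decidable_oracle:
  assumes "computable_from A f" shows "decidable_from A (\<lambda>x. f x \<in> A)"
  unfolding decidable_from_def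
  by (rule computable_comp[OF _ assms]) (rule computable_fromI[OF runs_Query])

text \<open>The step function is curried in the conclusion and uncurried in the premise. So
  \<open>intro\<close> can match a recursion occurring in a goal and hand on a goal about a single
  argument, packed in the way \<open>PrimRec\<close> passes it.\<close>

lemma computable_rec:
  assumes "computable_from A f" "computable_from A (\<lambda>u. G (pr1 u) (pr1 (pr2 u)) (pr2 (pr2 u)))"
    and b: "computable_from A b"
  shows "computable_from A (\<lambda>x. rec_nat (f x) (\<lambda>n y. G x n y) (b x))"
proof -
  obtain p q where p: "\<And>x. runs A p x (f x)"
    and q: "\<And>u. runs A q u (G (pr1 u) (pr1 (pr2 u)) (pr2 (pr2 u)))"
    using assms(1,2) unfolding computable_from_def by blast
  have "runs A (PrimRec p q) (prod_encode (x, n)) (rec_nat (f x) (\<lambda>n y. G x n y) n)" for x n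
  proof (induction n)
    case 0
    show ?case using runs_PrimRec_0[OF p] by simp
  next
    case (Suc n)
    show ?case using runs_PrimRec_Suc[OF Suc q] by simp
  qed
  then have "computable_from A (\<lambda>u. rec_nat (f (pr1 u)) (\<lambda>n y. G (pr1 u) n y) (pr2 u))"
    by (intro computable_fromI[where p="PrimRec p q"]) (metis prod_decode_inverse prod.collapse)
  from computable_comp[OF this computable_pair[OF computable_id b]] show ?thesis by simp
qed

section \<open>Arithmetic, decidable relations and bounded search\<close>

lemma computable_add:
  assumes "computable_from A f" "computable_from A g"
  shows "computable_from A (\<lambda>x. f x + g x)"
proof -
  have "rec_nat a (\<lambda>n y. Suc y) b = a + b" for a b by (induction b) auto
  moreover have "computable_from A (\<lambda>x. rec_nat (f x) (\<lambda>n y. Suc y) (g x))"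
    by (intro computable_rec computable_Suc computable_snd computable_id assms)
  ultimately show ?thesis by simp
qed

lemma computable_mult:
  assumes "computable_from A f" "computable_from A g"
  shows "computable_from A (\<lambda>x. f x * g x)"
proof -
  have "rec_nat 0 (\<lambda>n y. y + a) b = a * b" for a b :: nat by (induction b) auto
  moreover have "computable_from A (\<lambda>x. rec_nat 0 (\<lambda>n y. y + f x) (g x))"
    by (intro computable_rec computable_const computable_add computable_snd computable_fst
        computable_id assms computable_comp[OF assms(1)])
  ultimately show ?thesis by simp
qed

lemma computable_power:
  assumes "computable_from A f" "computable_from A g"
  shows "computable_from A (\<lambda>x. f x ^ g x)"
proof -
  have "rec_nat 1 (\<lambda>n y. y * a) b = a ^ b" for a b :: nat by (induction b) auto
  moreover have "computable_from A (\<lambda>x. rec_nat 1 (\<lambda>n y. y * f x) (g x))"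
    by (intro computable_rec computable_const computable_mult computable_snd computable_fst
        computable_id assms computable_comp[OF assms(1)])
  ultimately show ?thesis by simp
qed

lemma computable_diff:
  assumes "computable_from A f" "computable_from A g"
  shows "computable_from A (\<lambda>x. f x - g x)"
proof -
  \<comment> \<open>The recursion step returns the counter and forgets the previous value, which
    gives the predecessor, with value 0 at 0.\<close>
  have pred: "rec_nat 0 (\<lambda>n y. n) b = b - 1" for b :: nat by (cases b) auto
  have "computable_from A (\<lambda>x. rec_nat 0 (\<lambda>n y. n) x)"
    by (intro computable_rec computable_const computable_snd computable_fst computable_id)
  then have *: "computable_from A (\<lambda>x. x - 1)" unfolding pred .
  have "rec_nat a (\<lambda>n y. y - 1) b = a - b" for a b :: nat by (induction b) auto
  moreover have "computable_from A (\<lambda>x. rec_nat (f x) (\<lambda>n y. y - 1) (g x))"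
    by (intro computable_rec computable_comp[OF *] computable_snd computable_fst
        computable_id assms)
  ultimately show ?thesis by simp
qed

lemma decidable_le:
  assumes "computable_from A f" "computable_from A g"
  shows "decidable_from A (\<lambda>x. f x \<le> g x)"
proof -
  have "computable_from A (\<lambda>x. 1 - (f x - g x))"
    by (intro computable_diff computable_const assms)
  moreover have "1 - (f x - g x) = of_bool (f x \<le> g x)" for x by auto
  ultimately show ?thesis unfolding decidable_from_def by simp
qed

lemma decidable_not:
  assumes "decidable_from A P" shows "decidable_from A (\<lambda>x. \<not> P x)"
proof -
  have "computable_from A (\<lambda>x. 1 - of_bool (P x))"
    by (intro computable_diff computable_const assms[unfolded decidable_from_def])
  moreover have "1 - of_bool (P x) = (of_bool (\<not> P x) :: nat)" for x by auto
  ultimately show ?thesis unfolding decidable_from_def by simp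
qed

lemma decidable_conj:
  assumes "decidable_from A P" "decidable_from A Q"
  shows "decidable_from A (\<lambda>x. P x \<and> Q x)"
proof -
  have "computable_from A (\<lambda>x. of_bool (P x) * of_bool (Q x))"
    by (intro computable_mult assms[unfolded decidable_from_def])
  moreover have "of_bool (P x) * of_bool (Q x) = (of_bool (P x \<and> Q x) :: nat)" for x by auto
  ultimately show ?thesis unfolding decidable_from_def by simp
qed

lemma decidable_disj:
  assumes "decidable_from A P" "decidable_from A Q"
  shows "decidable_from A (\<lambda>x. P x \<or> Q x)"
proof -
  have "decidable_from A (\<lambda>x. \<not> (\<not> P x \<and> \<not> Q x))"
    by (intro decidable_conj decidable_not assms)
  then show ?thesis by simp
qed

lemma decidable_imp:
  assumes "decidable_from A P" "decidable_from A Q"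
  shows "decidable_from A (\<lambda>x. P x \<longrightarrow> Q x)"
proof -
  have "decidable_from A (\<lambda>x. \<not> P x \<or> Q x)"
    by (intro decidable_disj decidable_not assms)
  then show ?thesis unfolding imp_conv_disj .
qed

lemma decidable_less:
  assumes "computable_from A f" "computable_from A g"
  shows "decidable_from A (\<lambda>x. f x < g x)"
  using decidable_le[OF computable_Suc[OF assms(1)] assms(2)] by (simp add: Suc_le_eq)

lemma decidable_eq:
  assumes "computable_from A f" "computable_from A g"
  shows "decidable_from A (\<lambda>x. f x = g x)"
  using decidable_conj[OF decidable_le[OF assms] decidable_le[OF assms(2,1)]]
  by (simp add: eq_iff)

lemma computable_of_bool:
  "decidable_from A P \<Longrightarrow> computable_from A (\<lambda>x. of_bool (P x))"
  by (simp add: decidable_from_def)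

lemma computable_if:
  assumes "decidable_from A P" "computable_from A f" "computable_from A g"
  shows "computable_from A (\<lambda>x. if P x then f x else g x)"
proof -
  have "computable_from A (\<lambda>x. of_bool (P x) * f x + of_bool (\<not> P x) * g x)"
    by (intro computable_add computable_mult computable_of_bool decidable_not assms)
  moreover have "of_bool (P x) * f x + of_bool (\<not> P x) * g x = (if P x then f x else g x)" for x
    by auto
  ultimately show ?thesis by simp
qed

lemma decidable_if:
  assumes "decidable_from A P" "decidable_from A Q" "decidable_from A R"
  shows "decidable_from A (\<lambda>x. if P x then Q x else R x)"
  using decidable_conj[OF decidable_imp[OF assms(1,2)]
      decidable_imp[OF decidable_not[OF assms(1)] assms(3)]]
  by (rule back_subst) auto

lemma computable_sum:
  assumes "computable_from A b" and F: "computable_from A (\<lambda>u. F (pr1 u) (pr2 u))"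
  shows "computable_from A (\<lambda>x. \<Sum>i<b x. F i x)"
proof -
  have "rec_nat 0 (\<lambda>n y. y + F n x) k = (\<Sum>i<k. F i x)" for k x by (induction k) auto
  moreover have "computable_from A (\<lambda>u. F (pr1 (pr2 u)) (pr1 u))"
    using computable_comp[OF F computable_pair[OF
          computable_fst[OF computable_snd[OF computable_id]] computable_fst[OF computable_id]]]
    by simp
  then have "computable_from A (\<lambda>x. rec_nat 0 (\<lambda>n y. y + F n x) (b x))"
    by (intro computable_rec computable_const computable_add computable_snd computable_id assms)
  ultimately show ?thesis by simp
qed

lemma decidable_bex:
  assumes "computable_from A b" "decidable_from A (\<lambda>u. P (pr1 u) (pr2 u))"
  shows "decidable_from A (\<lambda>x. \<exists>i<b x. P i x)"
proof -
  have "decidable_from A (\<lambda>x. 0 < (\<Sum>i<b x. of_bool (P i x) :: nat))"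
    using assms by (intro decidable_less computable_const computable_sum)
      (simp_all add: decidable_from_def)
  moreover have "0 < (\<Sum>i<b x. of_bool (P i x) :: nat) \<longleftrightarrow> (\<exists>i<b x. P i x)" for x
    by (auto simp: sum_eq_0_iff zero_less_iff_neq_zero simp del: neq0_conv)
  ultimately show ?thesis by simp
qed

lemma decidable_ball:
  assumes "computable_from A b" "decidable_from A (\<lambda>u. P (pr1 u) (pr2 u))"
  shows "decidable_from A (\<lambda>x. \<forall>i<b x. P i x)"
  using decidable_not[OF decidable_bex[OF assms(1) decidable_not[OF assms(2)]]]
  by simp

lemma computable_card:
  assumes "computable_from A b" "decidable_from A (\<lambda>u. P (pr1 u) (pr2 u))"
  shows "computable_from A (\<lambda>x. card {i. i < b x \<and> P i x})"
proof -
  have "computable_from A (\<lambda>x. \<Sum>i<b x. of_bool (P i x))"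
    using assms by (intro computable_sum) (simp_all add: decidable_from_def)
  moreover have "(\<Sum>i<b x. of_bool (P i x)) = card {i. i < b x \<and> P i x}" for x
    by (simp add: sum_of_bool_eq Int_def)
  ultimately show ?thesis by simp
qed

lemma computable_div:
  assumes "computable_from A f" "computable_from A g"
  shows "computable_from A (\<lambda>x. f x div g x)"
proof -
  \<comment> \<open>The quotient counts the positive multiples of \<open>n\<close> up to
    \<open>m\<close>. There are at most \<open>m\<close> of them, so the count is bounded; division
    by 0 gives 0 as in HOL.\<close>
  have "m div n = (if n = 0 then 0 else card {i. i < m \<and> Suc i * n \<le> m})" for m n :: nat
  proof (cases "n = 0")
    case False
    have "Suc i * n \<le> m \<longleftrightarrow> i < m div n" for i
      using False by (metis Suc_le_eq bot_nat_0.not_eq_extremum less_eq_div_iff_mult_less_eq)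
    moreover have "i < m div n \<Longrightarrow> i < m" for i
      by (meson div_le_dividend less_le_trans)
    ultimately have "{i. i < m \<and> Suc i * n \<le> m} = {..<m div n}" by auto
    then show ?thesis using False by simp
  qed auto
  moreover have "computable_from A (\<lambda>x. if g x = 0 then 0 else card {i. i < f x \<and> Suc i * g x \<le> f x})"
    by (intro computable_if computable_card decidable_eq decidable_le computable_mult computable_Suc
        computable_const computable_fst computable_id assms
        computable_comp[OF assms(1)] computable_comp[OF assms(2)] computable_snd)
  ultimately show ?thesis by simp
qed

lemma computable_mod:
  assumes "computable_from A f" "computable_from A g"
  shows "computable_from A (\<lambda>x. f x mod g x)"
  using computable_diff[OF assms(1) computable_mult[OF computable_div[OF assms] assms(2)]]
  by (simp add: minus_div_mult_eq_mod)

text \<open>\<open>Mu\<close> searches for the output 0, hence the program decides the negation of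
  the predicate.\<close>

lemma runs_Mu_Least:
  assumes p: "\<And>u. runs A p u (of_bool (\<not> P (pr1 u) (pr2 u)))" and ex: "\<exists>n. P x n"
  shows "runs A (Mu p) x (LEAST n. P x n)"
proof (rule runs_Mu)
  show "runs A p (prod_encode (x, LEAST n. P x n)) 0"
    using p[of "prod_encode (x, LEAST n. P x n)"] LeastI_ex[OF ex] by simp
  show "\<forall>m<LEAST n. P x n. \<exists>y. runs A p (prod_encode (x, m)) (Suc y)"
  proof (intro allI impI exI)
    fix m assume "m < (LEAST n. P x n)"
    then show "runs A p (prod_encode (x, m)) (Suc 0)"
      using p[of "prod_encode (x, m)"] not_less_Least by fastforce
  qed
qed

lemma computable_Least:
  assumes "decidable_from A (\<lambda>u. P (pr1 u) (pr2 u))" and ex: "\<And>x. \<exists>n. P n x"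
  shows "computable_from A (\<lambda>x. LEAST n. P n x)"
proof -
  have "decidable_from A (\<lambda>u. P (pr2 u) (pr1 u))"
    using computable_comp[OF assms(1)[unfolded decidable_from_def]
        computable_pair[OF computable_snd[OF computable_id] computable_fst[OF computable_id]]]
    by (simp add: decidable_from_def)
  then obtain p where p: "\<And>u. runs A p u (of_bool (\<not> P (pr2 u) (pr1 u)))"
    using decidable_not[of A "\<lambda>u. P (pr2 u) (pr1 u)"]
    unfolding decidable_from_def computable_from_def by blast
  have "runs A (Mu p) x (LEAST n. P n x)" for x
    using p ex by (rule runs_Mu_Least[where P="\<lambda>x n. P n x"])
  then show ?thesis by (rule computable_fromI)
qed

lemma decidable_comp:
  "decidable_from A P \<Longrightarrow> computable_from A g \<Longrightarrow> decidable_from A (\<lambda>x. P (g x))"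
  unfolding decidable_from_def by (rule computable_comp)

lemma decidable_const: "decidable_from A (\<lambda>x. c)"
  unfolding decidable_from_def by (rule computable_const)

lemma decidable_comp2:
  assumes "decidable_from A (\<lambda>u. P (pr1 u) (pr2 u))" "computable_from A f" "computable_from A g"
  shows "decidable_from A (\<lambda>x. P (f x) (g x))"
  using decidable_comp[OF assms(1) computable_pair[OF assms(2,3)]] by simp

lemma decidable_comp3:
  assumes "decidable_from A (\<lambda>u. P (pr1 u) (pr1 (pr2 u)) (pr2 (pr2 u)))"
    "computable_from A f" "computable_from A g" "computable_from A h"
  shows "decidable_from A (\<lambda>x. P (f x) (g x) (h x))"
  using decidable_comp[OF assms(1) computable_pair[OF assms(2) computable_pair[OF assms(3,4)]]]
  by simp

text \<open>Composition is left out, since its conclusion unifies with any goal; it is only applied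
  with an instantiated premise.\<close>

lemmas computable_intros =
  computable_id computable_const computable_Suc computable_fst computable_snd computable_pair
  computable_add computable_mult computable_power computable_diff computable_div computable_mod
  computable_of_bool computable_if computable_sum computable_card computable_rec
  decidable_le decidable_less decidable_eq decidable_not decidable_conj decidable_disj
  decidable_imp decidable_if decidable_bex decidable_ball decidable_const

text \<open>The empty oracle answers every query with 0, so putting \<open>Zero\<close> for
  \<open>Query\<close> lets any oracle imitate a computation over the empty one.\<close>

primrec oracle_free :: "program \<Rightarrow> program" where
  "oracle_free Zero = Zero"
| "oracle_free Succ = Succ"
| "oracle_free Fst = Fst"
| "oracle_free Snd = Snd"
| "oracle_free Query = Zero"
| "oracle_free (PairOf p q) = PairOf (oracle_free p) (oracle_free q)"
| "oracle_free (Comp p q) = Comp (oracle_free p) (oracle_free q)"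
| "oracle_free (PrimRec p q) = PrimRec (oracle_free p) (oracle_free q)"
| "oracle_free (Mu p) = Mu (oracle_free p)"

lemma runs_oracle_free: "runs {} p x y \<Longrightarrow> runs A (oracle_free p) x y"
proof (induction rule: runs.induct)
  case (runs_Mu p x n)
  then show ?case by (auto intro!: runs.runs_Mu)
qed (auto intro: runs.intros)

lemma computable_imp_computable_from: "computable f \<Longrightarrow> computable_from A f"
  unfolding computable_def computable_from_def using runs_oracle_free by blast

lemma computable_iff_computable_from: "computable f \<longleftrightarrow> computable_from {} f"
  by (simp add: computable_def computable_from_def)

lemma turing_computes_iff_decidable_from: "turing_computes A B \<longleftrightarrow> decidable_from A (\<lambda>x. x \<in> B)"
  by (simp add: turing_computes_def decidable_from_def computable_from_def)

text \<open>This serves to correct a decision procedure at finitely many arguments.\<close>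

lemma decidable_finite: "finite F \<Longrightarrow> decidable_from A (\<lambda>x. x \<in> F)"
proof (induction rule: finite_induct)
  case empty show ?case by (simp add: decidable_const)
next
  case (insert a F)
  have "decidable_from A (\<lambda>x. x = a \<or> x \<in> F)"
    by (rule decidable_disj[OF decidable_eq[OF computable_id computable_const] insert.IH])
  then show ?case by simp
qed

section \<open>A universal evaluator\<close>

text \<open>
  The bits of a number \<open>d\<close> code a finite set of facts \<open>(e, x, y)\<close>, read as: program number \<open>e\<close> maps
  \<open>x\<close> to \<open>y\<close>. A fact is justified by \<open>step_ok s k d\<close> if it follows in one step from facts in \<open>d\<close>, where
  the oracle is a string of length \<open>s\<close>, namely the binary digits of \<open>k\<close>, the leading one first.
\<close>

definition fact_mem :: "nat \<Rightarrow> nat \<Rightarrow> nat \<Rightarrow> nat \<Rightarrow> bool" where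
  "fact_mem d e x y \<longleftrightarrow> d div 2 ^ prod_encode (e, prod_encode (x, y)) mod 2 = 1"

definition step_ok :: "nat \<Rightarrow> nat \<Rightarrow> nat \<Rightarrow> nat \<Rightarrow> nat \<Rightarrow> nat \<Rightarrow> bool" where
  "step_ok s k d e x y \<longleftrightarrow>
    (if e = 0 then y = 0
     else if e = 1 then y = Suc x
     else if e = 2 then y = pr1 x
     else if e = 3 then y = pr2 x
     else if e = 4 then x < s \<and> y = k div 2 ^ (s - Suc x) mod 2
     else if (e - 5) mod 4 = 0 then
       fact_mem d (pr1 ((e - 5) div 4)) x (pr1 y) \<and> fact_mem d (pr2 ((e - 5) div 4)) x (pr2 y)
     else if (e - 5) mod 4 = 1 then
       \<exists>u<d. fact_mem d (pr2 ((e - 5) div 4)) x u \<and> fact_mem d (pr1 ((e - 5) div 4)) u y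
     else if (e - 5) mod 4 = 2 then
       (if pr2 x = 0 then fact_mem d (pr1 ((e - 5) div 4)) (pr1 x) y
        else \<exists>u<d. fact_mem d e (prod_encode (pr1 x, pr2 x - 1)) u \<and>
          fact_mem d (pr2 ((e - 5) div 4)) (prod_encode (pr1 x, prod_encode (pr2 x - 1, u))) y)
     else fact_mem d ((e - 5) div 4) (prod_encode (x, y)) 0 \<and>
       (\<forall>m<y. \<exists>u<d. fact_mem d ((e - 5) div 4) (prod_encode (x, m)) (Suc u)))"

definition valid :: "nat \<Rightarrow> nat \<Rightarrow> nat \<Rightarrow> bool" where
  "valid s k d \<longleftrightarrow> (\<forall>t<d. d div 2 ^ t mod 2 = 1 \<longrightarrow> step_ok s k d (pr1 t) (pr1 (pr2 t)) (pr2 (pr2 t)))"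

text \<open>The length \<open>s\<close> of the oracle string also bounds the code of the derivation.
  This makes the relation decidable, and a longer string only allows more derivations.\<close>

definition sim :: "nat \<Rightarrow> nat \<Rightarrow> nat \<Rightarrow> nat \<Rightarrow> nat \<Rightarrow> bool" where
  "sim s k e x y \<longleftrightarrow> (\<exists>d<s. fact_mem d e x y \<and> valid s k d)"

definition agrees :: "nat set \<Rightarrow> nat \<Rightarrow> nat \<Rightarrow> bool" where
  "agrees A s k \<longleftrightarrow> (\<forall>x<s. k div 2 ^ (s - Suc x) mod 2 = of_bool (x \<in> A))"

lemma decidable_fact_mem:
  assumes "computable_from A d" "computable_from A e" "computable_from A x" "computable_from A y"
  shows "decidable_from A (\<lambda>u. fact_mem (d u) (e u) (x u) (y u))"
  unfolding fact_mem_def by (intro computable_intros assms)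

lemma decidable_sim:
  assumes "computable_from A s" "computable_from A k" "computable_from A e" "computable_from A x"
    "computable_from A y"
  shows "decidable_from A (\<lambda>u. sim (s u) (k u) (e u) (x u) (y u))"
proof -
  have "decidable_from A (\<lambda>u. sim (pr1 u) (pr1 (pr2 u)) (pr1 (pr2 (pr2 u)))
      (pr1 (pr2 (pr2 (pr2 u)))) (pr2 (pr2 (pr2 (pr2 u)))))"
    unfolding sim_def valid_def step_ok_def by (intro computable_intros decidable_fact_mem)
  from decidable_comp[OF this computable_pair[OF assms(1) computable_pair[OF assms(2)
        computable_pair[OF assms(3) computable_pair[OF assms(4,5)]]]]]
  show ?thesis by simp
qed

lemma fact_mem_iff: "fact_mem d e x y \<longleftrightarrow> prod_encode (e, prod_encode (x, y)) \<in> set_decode d"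
  by (simp add: fact_mem_def set_decode_def odd_iff_mod_2_eq_one)

lemma in_set_decode_less: "t \<in> set_decode d \<Longrightarrow> t < d"
proof -
  assume "t \<in> set_decode d"
  then have "2 ^ t \<le> d"
    by (metis (no_types) div_less even_zero mem_Collect_eq not_le set_decode_def)
  moreover have "t < 2 ^ t" by (rule less_exp)
  ultimately show "t < d" by linarith
qed

text \<open>For this reason the bounds \<open>u < d\<close> in \<open>step_ok\<close> lose no
  justification, while they keep it decidable.\<close>

lemma fact_mem_less: "fact_mem d e x y \<Longrightarrow> x < d \<and> y < d"
  unfolding fact_mem_iff
  using in_set_decode_less le_prod_encode_1 le_prod_encode_2 by (meson le_less_trans)

lemma valid_iff:
  "valid s k d \<longleftrightarrow> (\<forall>e x y. fact_mem d e x y \<longrightarrow> step_ok s k d e x y)"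
proof
  assume v: "valid s k d"
  show "\<forall>e x y. fact_mem d e x y \<longrightarrow> step_ok s k d e x y"
  proof (intro allI impI)
    fix e x y assume "fact_mem d e x y"
    then show "step_ok s k d e x y"
      using v[unfolded valid_def, rule_format, of "prod_encode (e, prod_encode (x, y))"]
        in_set_decode_less[of "prod_encode (e, prod_encode (x, y))" d]
      by (simp add: fact_mem_iff) (simp add: fact_mem_iff[symmetric] fact_mem_def)
  qed
next
  assume *: "\<forall>e x y. fact_mem d e x y \<longrightarrow> step_ok s k d e x y"
  show "valid s k d" unfolding valid_def
  proof (intro allI impI)
    fix t assume "d div 2 ^ t mod 2 = 1"
    then have "fact_mem d (pr1 t) (pr1 (pr2 t)) (pr2 (pr2 t))" by (simp add: fact_mem_def)
    then show "step_ok s k d (pr1 t) (pr1 (pr2 t)) (pr2 (pr2 t))" using * by blast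
  qed
qed

lemma program_encode_div_mod:
  fixes c r :: nat
  assumes "r < 4"
  shows "(5 + r + 4 * c - 5) div 4 = c" "(5 + r + 4 * c - 5) mod 4 = r"
proof -
  have "5 + r + 4 * c - 5 = r + 4 * c" by simp
  then show "(5 + r + 4 * c - 5) div 4 = c" "(5 + r + 4 * c - 5) mod 4 = r"
    using assms by simp_all
qed

lemma step_ok_simps:
  "step_ok s k d (program_encode Zero) x y \<longleftrightarrow> y = 0"
  "step_ok s k d (program_encode Succ) x y \<longleftrightarrow> y = Suc x"
  "step_ok s k d (program_encode Fst) x y \<longleftrightarrow> y = pr1 x"
  "step_ok s k d (program_encode Snd) x y \<longleftrightarrow> y = pr2 x"
  "step_ok s k d (program_encode Query) x y \<longleftrightarrow> x < s \<and> y = k div 2 ^ (s - Suc x) mod 2"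
  "step_ok s k d (program_encode (PairOf p q)) x y \<longleftrightarrow>
     fact_mem d (program_encode p) x (pr1 y) \<and> fact_mem d (program_encode q) x (pr2 y)"
  "step_ok s k d (program_encode (Comp p q)) x y \<longleftrightarrow>
     (\<exists>u<d. fact_mem d (program_encode q) x u \<and> fact_mem d (program_encode p) u y)"
  "step_ok s k d (program_encode (PrimRec p q)) x y \<longleftrightarrow>
     (if pr2 x = 0 then fact_mem d (program_encode p) (pr1 x) y
      else \<exists>u<d. fact_mem d (program_encode (PrimRec p q)) (prod_encode (pr1 x, pr2 x - 1)) u \<and>
        fact_mem d (program_encode q) (prod_encode (pr1 x, prod_encode (pr2 x - 1, u))) y)"
  "step_ok s k d (program_encode (Mu p)) x y \<longleftrightarrow>
     fact_mem d (program_encode p) (prod_encode (x, y)) 0 \<and>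
     (\<forall>m<y. \<exists>u<d. fact_mem d (program_encode p) (prod_encode (x, m)) (Suc u))"
proof -
  have m: "(5 + 4 * c - 5) mod 4 = 0" "(5 + 4 * c - 5) div 4 = c"
    "(6 + 4 * c - 5) mod 4 = 1" "(6 + 4 * c - 5) div 4 = c"
    "(7 + 4 * c - 5) mod 4 = 2" "(7 + 4 * c - 5) div 4 = c"
    "(8 + 4 * c - 5) mod 4 = 3" "(8 + 4 * c - 5) div 4 = c" for c :: nat
    using program_encode_div_mod[of 0 c] program_encode_div_mod[of 1 c]
      program_encode_div_mod[of 2 c] program_encode_div_mod[of 3 c] by simp_all
  show "step_ok s k d (program_encode Zero) x y \<longleftrightarrow> y = 0"
    "step_ok s k d (program_encode Succ) x y \<longleftrightarrow> y = Suc x"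
    "step_ok s k d (program_encode Fst) x y \<longleftrightarrow> y = pr1 x"
    "step_ok s k d (program_encode Snd) x y \<longleftrightarrow> y = pr2 x"
    "step_ok s k d (program_encode Query) x y \<longleftrightarrow> x < s \<and> y = k div 2 ^ (s - Suc x) mod 2"
    by (simp_all add: step_ok_def)
  show "step_ok s k d (program_encode (PairOf p q)) x y \<longleftrightarrow>
     fact_mem d (program_encode p) x (pr1 y) \<and> fact_mem d (program_encode q) x (pr2 y)"
    unfolding step_ok_def program_encode.simps m by simp
  show "step_ok s k d (program_encode (Comp p q)) x y \<longleftrightarrow>
     (\<exists>u<d. fact_mem d (program_encode q) x u \<and> fact_mem d (program_encode p) u y)"
    unfolding step_ok_def program_encode.simps m by simp
  show "step_ok s k d (program_encode (PrimRec p q)) x y \<longleftrightarrow>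
     (if pr2 x = 0 then fact_mem d (program_encode p) (pr1 x) y
      else \<exists>u<d. fact_mem d (program_encode (PrimRec p q)) (prod_encode (pr1 x, pr2 x - 1)) u \<and>
        fact_mem d (program_encode q) (prod_encode (pr1 x, prod_encode (pr2 x - 1, u))) y)"
    unfolding step_ok_def program_encode.simps m by simp
  show "step_ok s k d (program_encode (Mu p)) x y \<longleftrightarrow>
     fact_mem d (program_encode p) (prod_encode (x, y)) 0 \<and>
     (\<forall>m<y. \<exists>u<d. fact_mem d (program_encode p) (prod_encode (x, m)) (Suc u))"
    unfolding step_ok_def program_encode.simps m by simp
qed

section \<open>Soundness and completeness of the evaluator\<close>

lemma fact_mem_mono: "fact_mem d e x y \<Longrightarrow> set_decode d \<subseteq> set_decode d' \<Longrightarrow> fact_mem d' e x y"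
  by (auto simp: fact_mem_iff)

text \<open>A set of facts in which each fact is justified by others is sound: justification leads to
  subprograms, or to a smaller recursion argument, so it cannot be circular.\<close>

lemma valid_sound:
  assumes v: "valid s k d" and a: "agrees A s k"
  shows "fact_mem d (program_encode p) x y \<Longrightarrow> runs A p x y"
proof (induction p arbitrary: x y)
  case Zero
  then have "step_ok s k d (program_encode Zero) x y" using v valid_iff by blast
  then show ?case unfolding step_ok_simps by (simp add: runs_Zero)
next
  case Succ
  then have "step_ok s k d (program_encode Succ) x y" using v valid_iff by blast
  then show ?case unfolding step_ok_simps by (simp add: runs_Succ)
next
  case Fst
  then have "step_ok s k d (program_encode Fst) x y" using v valid_iff by blast
  then show ?case unfolding step_ok_simps by (simp add: runs_Fst)
next
  case Snd
  then have "step_ok s k d (program_encode Snd) x y" using v valid_iff by blast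
  then show ?case unfolding step_ok_simps by (simp add: runs_Snd)
next
  case Query
  then have "step_ok s k d (program_encode Query) x y" using v valid_iff by blast
  then show ?case unfolding step_ok_simps using a runs_Query[of A x] by (simp add: agrees_def)
next
  case (PairOf p q)
  then have "step_ok s k d (program_encode (PairOf p q)) x y" using v valid_iff by blast
  then have "runs A p x (pr1 y)" "runs A q x (pr2 y)"
    unfolding step_ok_simps using PairOf.IH by blast+
  from runs_PairOf[OF this] show ?case by simp
next
  case (Comp p q)
  then have "step_ok s k d (program_encode (Comp p q)) x y" using v valid_iff by blast
  then show ?case unfolding step_ok_simps using Comp.IH runs_Comp by blast
next
  case (PrimRec p q)
  \<comment> \<open>A recursion fact may be justified by a fact about the same program, so an inner
    induction on the counter is required.\<close>
  have "fact_mem d (program_encode (PrimRec p q)) (prod_encode (x, n)) y \<Longrightarrow>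
      runs A (PrimRec p q) (prod_encode (x, n)) y" for x n y
  proof (induction n arbitrary: y)
    case 0
    then have "step_ok s k d (program_encode (PrimRec p q)) (prod_encode (x, 0)) y"
      using v valid_iff by blast
    then show ?case unfolding step_ok_simps using PrimRec.IH(1) by (auto intro: runs_PrimRec_0)
  next
    case (Suc n)
    then have "step_ok s k d (program_encode (PrimRec p q)) (prod_encode (x, Suc n)) y"
      using v valid_iff by blast
    then obtain u where
      "fact_mem d (program_encode (PrimRec p q)) (prod_encode (x, n)) u"
      "fact_mem d (program_encode q) (prod_encode (x, prod_encode (n, u))) y"
      unfolding step_ok_simps by (auto simp del: program_encode.simps)
    then show ?case using Suc.IH PrimRec.IH(2) by (auto intro: runs_PrimRec_Suc)
  qed
  from this[of "pr1 x" "pr2 x" y] PrimRec.prems show ?case by simp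
next
  case (Mu p)
  then have "step_ok s k d (program_encode (Mu p)) x y" using v valid_iff by blast
  then show ?case unfolding step_ok_simps using Mu.IH by (blast intro: runs_Mu)
qed

text \<open>Facts occur only positively in the rules, and a larger set of facts has a larger code,
  so the bounds \<open>u < d\<close> only weaken.\<close>

lemma step_ok_mono:
  assumes "step_ok s k d e x y" "set_decode d \<subseteq> set_decode d'"
  shows "step_ok s k d' e x y"
proof -
  have "d \<le> d'" by (rule subset_decode_imp_le[OF assms(2)])
  then show ?thesis using assms(1) unfolding step_ok_def
    by (simp split: if_splits) (meson fact_mem_mono[OF _ assms(2)] less_le_trans)+
qed

text \<open>A derivation makes finitely many queries, so all long enough prefixes of
  \<open>A\<close> justify it. Quantifying over all greater lengths allows several derivations to be
  merged.\<close>

definition eventually_valid :: "nat set \<Rightarrow> nat \<Rightarrow> bool" where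
  "eventually_valid A d \<longleftrightarrow> (\<exists>s. \<forall>s'\<ge>s. \<forall>k. agrees A s' k \<longrightarrow> valid s' k d)"

lemma valid_union:
  assumes "valid s k d" "valid s k d'"
  shows "valid s k (set_encode (set_decode d \<union> set_decode d'))"
proof -
  let ?u = "set_encode (set_decode d \<union> set_decode d')"
  have "set_decode d \<subseteq> set_decode ?u" "set_decode d' \<subseteq> set_decode ?u" by simp_all
  from this[THEN step_ok_mono[rotated]] show ?thesis
    using assms unfolding valid_iff fact_mem_iff by auto
qed

lemma eventually_valid_union:
  assumes "eventually_valid A d" "eventually_valid A d'"
  shows "eventually_valid A (set_encode (set_decode d \<union> set_decode d'))"
proof -
  obtain s s' where "\<forall>t\<ge>s. \<forall>k. agrees A t k \<longrightarrow> valid t k d"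
    "\<forall>t\<ge>s'. \<forall>k. agrees A t k \<longrightarrow> valid t k d'"
    using assms unfolding eventually_valid_def by blast
  then show ?thesis unfolding eventually_valid_def
    by (intro exI[of _ "max s s'"]) (auto intro: valid_union)
qed

lemma eventually_valid_insert:
  assumes "eventually_valid A d"
    and "\<And>s' k. s' \<ge> s \<Longrightarrow> agrees A s' k \<Longrightarrow> step_ok s' k d e x y"
  shows "\<exists>d'. set_decode d \<subseteq> set_decode d' \<and> eventually_valid A d' \<and> fact_mem d' e x y"
proof -
  let ?t = "prod_encode (e, prod_encode (x, y))"
  let ?d = "set_encode (insert ?t (set_decode d))"
  have dec: "set_decode ?d = insert ?t (set_decode d)" by simp
  obtain s1 where s1: "\<forall>t\<ge>s1. \<forall>k. agrees A t k \<longrightarrow> valid t k d"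
    using assms unfolding eventually_valid_def by blast
  have "valid s' k ?d" if "s' \<ge> max s s1" "agrees A s' k" for s' k
    unfolding valid_iff
  proof (intro allI impI)
    fix e' x' y' assume "fact_mem ?d e' x' y'"
    then have "step_ok s' k d e' x' y'"
      using s1 that assms(2)[of s' k] unfolding fact_mem_iff dec valid_iff
      by (auto simp: fact_mem_iff)
    then show "step_ok s' k ?d e' x' y'"
      by (rule step_ok_mono) (auto simp: dec)
  qed
  then have "eventually_valid A ?d" unfolding eventually_valid_def by blast
  then show ?thesis by (intro exI[of _ ?d]) (auto simp: fact_mem_iff)
qed

text \<open>The minimization rule has one premise for each smaller argument; this merges their
  derivations into one.\<close>

lemma eventually_valid_collect:
  fixes n :: nat
  assumes "\<forall>m<n. \<exists>d. eventually_valid A d \<and> P m d"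
    and "\<And>m d d'. P m d \<Longrightarrow> set_decode d \<subseteq> set_decode d' \<Longrightarrow> P m d'"
  shows "\<exists>d. eventually_valid A d \<and> (\<forall>m<n. P m d)"
  using assms(1)
proof (induction n)
  case 0
  have "eventually_valid A 0" by (auto simp: eventually_valid_def valid_def)
  then show ?case by auto
next
  case (Suc n)
  then obtain d where d: "eventually_valid A d" "\<forall>m<n. P m d" by auto
  obtain d' where d': "eventually_valid A d'" "P n d'" using Suc.prems by blast
  have sub: "set_decode d \<subseteq> set_decode (set_encode (set_decode d \<union> set_decode d'))"
    "set_decode d' \<subseteq> set_decode (set_encode (set_decode d \<union> set_decode d'))" by simp_all
  have "P m (set_encode (set_decode d \<union> set_decode d'))" if "m < Suc n" for m
    using that d(2) assms(2)[OF _ sub(1)] assms(2)[OF d'(2) sub(2)] by (cases "m = n") auto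
  then show ?case using eventually_valid_union[OF d(1) d'(1)] by blast
qed

text \<open>Induction on the computation: the derivations of the premises are united and the
  conclusion is added as one further fact. Axioms start from 0, the code of the empty set.\<close>

lemma runs_imp_eventually_valid:
  "runs A p x y \<Longrightarrow> \<exists>d. eventually_valid A d \<and> fact_mem d (program_encode p) x y"
proof (induction rule: runs.induct)
  case (runs_Zero x)
  have "eventually_valid A 0" by (auto simp: eventually_valid_def valid_def)
  from eventually_valid_insert[OF this, of 0 "program_encode Zero" x 0]
  show ?case unfolding step_ok_simps by blast
next
  case (runs_Succ x)
  have "eventually_valid A 0" by (auto simp: eventually_valid_def valid_def)
  from eventually_valid_insert[OF this, of 0 "program_encode Succ" x "Suc x"]
  show ?case unfolding step_ok_simps by blast
next
  case (runs_Fst x)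
  have "eventually_valid A 0" by (auto simp: eventually_valid_def valid_def)
  from eventually_valid_insert[OF this, of 0 "program_encode Fst" x "pr1 x"]
  show ?case unfolding step_ok_simps by blast
next
  case (runs_Snd x)
  have "eventually_valid A 0" by (auto simp: eventually_valid_def valid_def)
  from eventually_valid_insert[OF this, of 0 "program_encode Snd" x "pr2 x"]
  show ?case unfolding step_ok_simps by blast
next
  case (runs_Query x)
  have "eventually_valid A 0" by (auto simp: eventually_valid_def valid_def)
  \<comment> \<open>The digit at position \<open>x\<close> is present once the string has length at
    least \<open>Suc x\<close>.\<close>
  moreover have "step_ok s' k 0 (program_encode Query) x (of_bool (x \<in> A))"
    if "s' \<ge> Suc x" "agrees A s' k" for s' k
    using that unfolding step_ok_simps agrees_def by auto
  ultimately show ?case using eventually_valid_insert by blast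
next
  case (runs_PairOf p x y q z)
  then obtain d d' where d: "eventually_valid A d" "fact_mem d (program_encode p) x y"
    and d': "eventually_valid A d'" "fact_mem d' (program_encode q) x z" by blast
  let ?d = "set_encode (set_decode d \<union> set_decode d')"
  have "fact_mem ?d (program_encode p) x y" "fact_mem ?d (program_encode q) x z"
    using d(2) d'(2) by (simp_all add: fact_mem_iff)
  then have "step_ok s' k ?d (program_encode (PairOf p q)) x (prod_encode (y, z))" for s' k
    unfolding step_ok_simps by simp
  then show ?case using eventually_valid_insert[OF eventually_valid_union[OF d(1) d'(1)]] by blast
next
  case (runs_Comp q x y p z)
  then obtain d d' where d: "eventually_valid A d" "fact_mem d (program_encode q) x y"
    and d': "eventually_valid A d'" "fact_mem d' (program_encode p) y z" by blast
  let ?d = "set_encode (set_decode d \<union> set_decode d')"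
  have "fact_mem ?d (program_encode q) x y" "fact_mem ?d (program_encode p) y z"
    using d(2) d'(2) by (simp_all add: fact_mem_iff)
  then have "step_ok s' k ?d (program_encode (Comp p q)) x z" for s' k
    unfolding step_ok_simps using fact_mem_less by blast
  then show ?case using eventually_valid_insert[OF eventually_valid_union[OF d(1) d'(1)]] by blast
next
  case (runs_PrimRec_0 p x y q)
  then obtain d where d: "eventually_valid A d" "fact_mem d (program_encode p) x y" by blast
  then have "step_ok s' k d (program_encode (PrimRec p q)) (prod_encode (x, 0)) y" for s' k
    unfolding step_ok_simps by simp
  then show ?case using eventually_valid_insert[OF d(1)] by blast
next
  case (runs_PrimRec_Suc p q x n y z)
  then obtain d d' where
    d: "eventually_valid A d" "fact_mem d (program_encode (PrimRec p q)) (prod_encode (x, n)) y"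
    and d': "eventually_valid A d'"
      "fact_mem d' (program_encode q) (prod_encode (x, prod_encode (n, y))) z" by blast
  let ?d = "set_encode (set_decode d \<union> set_decode d')"
  have "fact_mem ?d (program_encode (PrimRec p q)) (prod_encode (x, n)) y"
    "fact_mem ?d (program_encode q) (prod_encode (x, prod_encode (n, y))) z"
    using d(2) d'(2) by (simp_all add: fact_mem_iff)
  then have "\<exists>u<?d. fact_mem ?d (program_encode (PrimRec p q)) (prod_encode (x, n)) u \<and>
      fact_mem ?d (program_encode q) (prod_encode (x, prod_encode (n, u))) z"
    using fact_mem_less by blast
  then have "step_ok s' k ?d (program_encode (PrimRec p q)) (prod_encode (x, Suc n)) z" for s' k
    unfolding step_ok_simps by (simp del: program_encode.simps)
  then show ?case using eventually_valid_insert[OF eventually_valid_union[OF d(1) d'(1)]] by blast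
next
  case (runs_Mu p x n)
  then obtain d where
    d: "eventually_valid A d" "fact_mem d (program_encode p) (prod_encode (x, n)) 0" by blast
  have "\<exists>d. eventually_valid A d \<and>
      (\<forall>m<n. \<exists>u. fact_mem d (program_encode p) (prod_encode (x, m)) (Suc u))"
    using runs_Mu by (intro eventually_valid_collect; blast intro: fact_mem_mono)
  then obtain d' where d': "eventually_valid A d'"
    "\<forall>m<n. \<exists>u. fact_mem d' (program_encode p) (prod_encode (x, m)) (Suc u)" by blast
  let ?d = "set_encode (set_decode d \<union> set_decode d')"
  have "fact_mem ?d (program_encode p) (prod_encode (x, n)) 0"
    "\<forall>m<n. \<exists>u. fact_mem ?d (program_encode p) (prod_encode (x, m)) (Suc u)"
    using d(2) d'(2) by (simp_all add: fact_mem_iff) blast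
  then have "step_ok s' k ?d (program_encode (Mu p)) x n" for s' k
    unfolding step_ok_simps using fact_mem_less Suc_lessD by blast
  then show ?case using eventually_valid_insert[OF eventually_valid_union[OF d(1) d'(1)]] by blast
qed

lemma sim_sound: "sim s k (program_encode p) x y \<Longrightarrow> agrees A s k \<Longrightarrow> runs A p x y"
  unfolding sim_def using valid_sound by blast

lemma sim_complete:
  assumes "runs A p x y"
  obtains s where "\<And>s' k. s' \<ge> s \<Longrightarrow> agrees A s' k \<Longrightarrow> sim s' k (program_encode p) x y"
proof -
  obtain d where d: "eventually_valid A d" "fact_mem d (program_encode p) x y"
    using runs_imp_eventually_valid[OF assms] by blast
  then obtain s where "\<forall>s'\<ge>s. \<forall>k. agrees A s' k \<longrightarrow> valid s' k d"
    unfolding eventually_valid_def by blast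
  \<comment> \<open>The length must also exceed \<open>d\<close>, because \<open>sim\<close> only
    admits derivations with codes below it.\<close>
  then show ?thesis using d(2) by (intro that[of "max s (Suc d)"]) (auto simp: sim_def intro!: exI[of _ d])
qed

text \<open>Division by \<open>2 ^ (s' - s)\<close> cuts a string of length \<open>s'\<close> down
  to its first \<open>s\<close> digits. A query answered by the shorter string gets the same answer
  from the longer one.\<close>

lemma step_ok_extend:
  assumes "step_ok s (k div 2 ^ (s' - s)) d e x y" "s \<le> s'"
  shows "step_ok s' k d e x y"
proof -
  have "k div 2 ^ (s' - s) div 2 ^ (s - Suc x) = k div 2 ^ (s' - Suc x)" if "x < s"
    using that assms(2) by (simp flip: div_mult2_eq power_add)
  then show ?thesis using assms unfolding step_ok_def by (simp split: if_splits)
qed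

lemma sim_extend:
  assumes "sim s (k div 2 ^ (s' - s)) e x y" "s \<le> s'"
  shows "sim s' k e x y"
  using assms(1) step_ok_extend[OF _ assms(2)] assms(2)
  unfolding sim_def valid_iff by (meson less_le_trans)

lemma agrees_empty: "agrees {} s 0"
  by (simp add: agrees_def)

section \<open>Dyadic cells\<close>

definition cell :: "nat \<Rightarrow> nat \<Rightarrow> real set" where
  "cell s k = {real k / 2 ^ s <..< real (Suc k) / 2 ^ s}"

text \<open>\<open>int_decode\<close> sends \<open>2 * k\<close> to \<open>k\<close>, so this is a
  code of the rational number \<open>k / 2 ^ s\<close> under \<open>nat_to_rat_surj\<close>.\<close>

definition dyadic_code :: "nat \<Rightarrow> nat \<Rightarrow> nat" where
  "dyadic_code s k = prod_encode (2 * k, 2 * 2 ^ s)"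

definition cell_code :: "nat \<Rightarrow> nat \<Rightarrow> nat" where
  "cell_code s k = prod_encode (dyadic_code s k, dyadic_code s (Suc k))"

text \<open>Read as a string of length \<open>s\<close>, this is the prefix of the binary expansion
  of \<open>z\<close>, for \<open>z\<close> in \<open>[0,1)\<close>.\<close>

definition cell_index :: "real \<Rightarrow> nat \<Rightarrow> nat" where
  "cell_index z s = nat \<lfloor>z * 2 ^ s\<rfloor>"

lemma int_decode_double: "int_decode (2 * k) = int k"
  by (simp add: int_decode_def sum_decode_def)

lemma nat_to_rat_surj_dyadic_code:
  "real_of_rat (nat_to_rat_surj (dyadic_code s k)) = real k / 2 ^ s"
  by (simp add: nat_to_rat_surj_def dyadic_code_def int_decode_double of_rat_rat)

lemma rat_interval_cell_code: "rat_interval (cell_code s k) = cell s k"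
  by (simp add: rat_interval_def cell_code_def nat_to_rat_surj_dyadic_code cell_def)

text \<open>Both endpoints decoded from 0 coincide. The code 0 thus serves as the default that adds
  nothing to an enumerated union.\<close>

lemma rat_interval_0: "rat_interval 0 = {}"
proof -
  have "prod_decode (prod_encode (0, 0)) = (0, 0)" by (rule prod_encode_inverse)
  moreover have "prod_encode (0, 0) = 0" by (simp add: prod_encode_def)
  ultimately have "prod_decode 0 = (0, 0)" by simp
  then show ?thesis by (simp add: rat_interval_def)
qed

lemma computable_dyadic_code:
  "computable_from A f \<Longrightarrow> computable_from A g \<Longrightarrow> computable_from A (\<lambda>x. dyadic_code (f x) (g x))"
  unfolding dyadic_code_def by (intro computable_intros)

lemma computable_cell_code:
  "computable_from A f \<Longrightarrow> computable_from A g \<Longrightarrow> computable_from A (\<lambda>x. cell_code (f x) (g x))"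
  unfolding cell_code_def by (intro computable_intros computable_dyadic_code)

lemma effectively_open_cells:
  assumes "decidable_from {} (\<lambda>u. R (pr1 u) (pr2 u))"
  shows "effectively_open ({0..1} \<inter> (\<Union>s. \<Union>k\<in>{k. R s k}. cell s k))"
proof -
  define f where "f u = (if R (pr1 u) (pr2 u) then cell_code (pr1 u) (pr2 u) else 0)" for u
  have "computable_from {} f" unfolding f_def
    by (intro computable_intros computable_cell_code assms)
  moreover have "(\<Union>u. rat_interval (f u)) = (\<Union>s. \<Union>k\<in>{k. R s k}. cell s k)" (is "?L = ?R")
  proof
    show "?L \<subseteq> ?R"
      by (auto simp: f_def rat_interval_cell_code rat_interval_0 split: if_splits) blast
    have "cell s k \<subseteq> rat_interval (f (prod_encode (s, k)))" if "R s k" for s k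
      using that by (simp add: f_def rat_interval_cell_code)
    then show "?R \<subseteq> ?L" by blast
  qed
  ultimately show ?thesis
    unfolding effectively_open_def computable_iff_computable_from by metis
qed

lemma uniformly_effectively_open_cells:
  assumes "decidable_from {} (\<lambda>u. R (pr1 u) (pr1 (pr2 u)) (pr2 (pr2 u)))"
  shows "uniformly_effectively_open (\<lambda>m. {0..1} \<inter> (\<Union>s. \<Union>k\<in>{k. R m s k}. cell s k))"
proof -
  define f where "f u = (if R (pr1 u) (pr1 (pr2 u)) (pr2 (pr2 u))
    then cell_code (pr1 (pr2 u)) (pr2 (pr2 u)) else 0)" for u
  have "computable_from {} f" unfolding f_def
    by (intro computable_intros computable_cell_code assms)
  moreover have "(\<Union>u. rat_interval (f (prod_encode (m, u)))) = (\<Union>s. \<Union>k\<in>{k. R m s k}. cell s k)"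
    (is "?L = ?R") for m
  proof
    show "?L \<subseteq> ?R"
      by (auto simp: f_def rat_interval_cell_code rat_interval_0 split: if_splits) blast
    have "cell s k \<subseteq> rat_interval (f (prod_encode (m, prod_encode (s, k))))" if "R m s k" for s k
      using that by (simp add: f_def rat_interval_cell_code)
    then show "?R \<subseteq> ?L" by blast
  qed
  ultimately show ?thesis
    unfolding uniformly_effectively_open_def computable_iff_computable_from by metis
qed

text \<open>Intervals of radius \<open>1 / 2 ^ (s + n + 2)\<close> around a dyadic rational form a
  Martin-Loef test.\<close>

lemma martin_loef_random_not_dyadic:
  assumes "martin_loef_random z" "z \<in> {0..1}"
  shows "z \<noteq> real k / 2 ^ s"
proof
  assume z: "z = real k / 2 ^ s"
  \<comment> \<open>\<open>dyadic_code\<close> covers nonnegative numbers only, so for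
    \<open>k = 0\<close> the left endpoint is -1, with code \<open>prod_encode (1, 2)\<close>.
    Intersecting with the unit interval removes the excess.\<close>
  define f where "f u = prod_encode (if k = 0 then prod_encode (1, 2)
      else dyadic_code (s + pr1 u + 2) (k * 2 ^ (pr1 u + 2) - 1),
      dyadic_code (s + pr1 u + 2) (Suc (k * 2 ^ (pr1 u + 2))))" for u
  define U where "U n = {0..1} \<inter> (\<Union>i. rat_interval (f (prod_encode (n, i))))" for n
  have "computable_from {} f" unfolding f_def
    by (intro computable_intros computable_dyadic_code)
  then have "uniformly_effectively_open U"
    unfolding uniformly_effectively_open_def computable_iff_computable_from U_def by blast
  have minus_one: "real_of_rat (nat_to_rat_surj (prod_encode (Suc 0, 2))) = -1"
    using int_decode_double[of 1]
    by (simp add: nat_to_rat_surj_def int_decode_def sum_decode_def of_rat_rat)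
  have eq: "real k * 2 ^ (n + 2) / 2 ^ (s + n + 2) = z" for n
    by (simp add: z power_add)
  define e where "e n = 1 / (2::real) ^ (s + n + 2)" for n
  have e: "e n > 0" "2 * e n \<le> (1 / 2) ^ n" for n
  proof -
    show "e n > 0" by (simp add: e_def)
    have "2 * e n = (1 / 2) ^ (s + 1) * (1 / 2) ^ n"
      by (simp add: e_def power_add power_one_over)
    also have "\<dots> \<le> 1 * (1 / 2) ^ n" by (intro mult_right_mono power_le_one) auto
    finally show "2 * e n \<le> (1 / 2) ^ n" by simp
  qed
  have I: "rat_interval (f (prod_encode (n, i))) = {(if k = 0 then -1 else z - e n) <..< z + e n}" for n i
  proof (cases "k = 0")
    case True
    then show ?thesis
      by (simp add: rat_interval_def f_def minus_one nat_to_rat_surj_dyadic_code z e_def)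
  next
    case False
    then have "real (k * 2 ^ (n + 2) - 1) = real k * 2 ^ (n + 2) - 1"
      by (subst of_nat_diff) auto
    then have "real (k * 2 ^ (n + 2) - 1) / 2 ^ (s + n + 2) = z - e n"
      unfolding e_def by (metis diff_divide_distrib eq)
    moreover have "real (Suc (k * 2 ^ (n + 2))) / 2 ^ (s + n + 2) = z + e n"
      unfolding e_def using eq[of n] by (simp add: add_divide_distrib del: power_Suc add_2_eq_Suc')
    ultimately show ?thesis using False
      by (simp add: rat_interval_def f_def nat_to_rat_surj_dyadic_code del: power_Suc add_2_eq_Suc')
  qed
  have "measure lborel (U n) \<le> (1 / 2) ^ n" for n
  proof -
    have "U n \<subseteq> {z - e n..z + e n}" using e(1)[of n] by (auto simp: U_def I z split: if_splits)
    then have "measure lborel (U n) \<le> measure lborel {z - e n..z + e n}"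
      by (intro measure_mono_fmeasurable) (auto simp: U_def I fmeasurable_def emeasure_lborel_Icc_eq)
    also have "\<dots> = 2 * e n" using e(1)[of n] by simp
    finally show ?thesis using e(2)[of n] by linarith
  qed
  moreover have "z \<in> U n" for n
    using assms(2) e(1)[of n] by (auto simp: U_def I z)
  ultimately show False
    using assms(1) \<open>uniformly_effectively_open U\<close> unfolding martin_loef_random_def by blast
qed

section \<open>Prefixes of binary expansions as cells\<close>

lemma cell_index_bounds:
  assumes "0 \<le> z"
  shows "real (cell_index z s) / 2 ^ s \<le> z" "z < real (Suc (cell_index z s)) / 2 ^ s"
proof -
  have "real (cell_index z s) = of_int \<lfloor>z * 2 ^ s\<rfloor>" using assms by (simp add: cell_index_def)
  then have "real (cell_index z s) \<le> z * 2 ^ s" "z * 2 ^ s < real (Suc (cell_index z s))"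
    by linarith+
  then show "real (cell_index z s) / 2 ^ s \<le> z" "z < real (Suc (cell_index z s)) / 2 ^ s"
    by (simp_all add: field_simps)
qed

lemma cell_index_less:
  assumes "0 \<le> z" "z < 1"
  shows "cell_index z s < 2 ^ s"
proof -
  have "z * 2 ^ s < 1 * 2 ^ s" using assms by (intro mult_strict_right_mono) auto
  then have "\<lfloor>z * 2 ^ s\<rfloor> < 2 ^ s" by (simp add: floor_less_iff)
  then show ?thesis using assms by (simp add: cell_index_def nat_less_iff)
qed

lemma cell_index_div:
  assumes "s \<le> t"
  shows "cell_index z t div 2 ^ (t - s) = cell_index z s"
proof -
  have "\<lfloor>z * 2 ^ t\<rfloor> div 2 ^ (t - s) = \<lfloor>z * 2 ^ t / real_of_int (2 ^ (t - s))\<rfloor>"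
    by (rule floor_divide_real_eq_div[symmetric]) simp
  also have "z * 2 ^ t / real_of_int (2 ^ (t - s)) = z * 2 ^ s"
    using power_add[of "2::real" s "t - s"] assms by simp
  finally show ?thesis
    unfolding cell_index_def by (metis nat_div_distrib' nat_power_eq nat_numeral zero_le_numeral zero_le_power)
qed

lemma cell_index_Suc:
  "cell_index z (Suc s) = 2 * cell_index z s + of_bool (s \<in> binary_expansion z)" if "0 \<le> z"
proof -
  have "odd (cell_index z (Suc s)) \<longleftrightarrow> s \<in> binary_expansion z"
    using that by (simp add: cell_index_def binary_expansion_def even_nat_iff del: power_Suc)
  moreover have "cell_index z (Suc s) div 2 = cell_index z s"
    using cell_index_div[of s "Suc s" z] by simp
  ultimately show ?thesis
    by (metis (full_types) add.commute bot_nat_0.not_eq_extremum even_iff_mod_2_eq_zero mod_mult_div_eq of_bool_eq(1) of_bool_eq(2) odd_iff_mod_2_eq_one)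
qed

text \<open>This links reals and oracles: a simulation on the string \<open>cell_index z s\<close>
  is a computation with oracle \<open>z\<close>.\<close>

lemma agrees_cell_index:
  assumes "0 \<le> z"
  shows "agrees (binary_expansion z) s (cell_index z s)"
  unfolding agrees_def
proof (intro allI impI)
  fix x assume "x < s"
  then have "cell_index z s div 2 ^ (s - Suc x) = cell_index z (Suc x)"
    by (intro cell_index_div) simp
  then show "cell_index z s div 2 ^ (s - Suc x) mod 2 = of_bool (x \<in> binary_expansion z)"
    using cell_index_Suc[OF assms] by simp
qed

text \<open>Cells are open, and randomness keeps \<open>z\<close> off their left endpoints.\<close>

lemma cell_index_in_cell:
  assumes "martin_loef_random z" "z \<in> {0..1}"
  shows "z \<in> cell s (cell_index z s)"
  using cell_index_bounds[of z s] martin_loef_random_not_dyadic[OF assms, of "cell_index z s" s] assms(2)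
  by (simp add: cell_def)

lemma martin_loef_random_bounds:
  assumes "martin_loef_random z" "z \<in> {0..1}"
  shows "0 < z" "z < 1"
  using martin_loef_random_not_dyadic[OF assms, of 0 0] martin_loef_random_not_dyadic[OF assms, of 1 0]
    assms(2) by auto

lemma mem_half_open_cell_iff:
  assumes "0 \<le> x"
  shows "x \<in> {real k / 2 ^ s ..< real (Suc k) / 2 ^ s} \<longleftrightarrow> cell_index x s = k"
proof
  assume "x \<in> {real k / 2 ^ s ..< real (Suc k) / 2 ^ s}"
  then have "real k \<le> x * 2 ^ s" "x * 2 ^ s < real k + 1" by (auto simp: field_simps)
  then have "\<lfloor>x * 2 ^ s\<rfloor> = int k" by (intro floor_unique) auto
  then show "cell_index x s = k" by (simp add: cell_index_def)
next
  assume "cell_index x s = k"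
  then show "x \<in> {real k / 2 ^ s ..< real (Suc k) / 2 ^ s}"
    using cell_index_bounds[OF assms] by auto
qed

section \<open>Decidable families of cells as Martin-Loef tests\<close>

lemma emeasure_half_open_cells_le:
  assumes "finite J"
  shows "emeasure lborel (\<Union>k\<in>J. {real k / 2 ^ s ..< real (Suc k) / 2 ^ s}) \<le> ennreal (card J / 2 ^ s)"
proof -
  have "emeasure lborel (\<Union>k\<in>J. {real k / 2 ^ s ..< real (Suc k) / 2 ^ s})
      \<le> (\<Sum>k\<in>J. emeasure lborel {real k / 2 ^ s ..< real (Suc k) / 2 ^ s})"
    using assms by (intro emeasure_subadditive_finite) auto
  also have "\<dots> = (\<Sum>k\<in>J. ennreal (1 / 2 ^ s))"
    by (intro sum.cong refl) (simp add: divide_right_mono add_divide_distrib)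
  also have "\<dots> = ennreal (card J / 2 ^ s)"
    by (subst sum_ennreal) auto
  finally show ?thesis .
qed

text \<open>Both directions use randomness in this form. By \<open>refine\<close> the unions of the
  chosen cells grow with the level, so the counting bound at each level passes to the measure of the
  whole union.\<close>

lemma martin_loef_random_escapes:
  assumes ml: "martin_loef_random z" "z \<in> {0..1}"
    and dec: "decidable_from {} (\<lambda>u. R (pr1 u) (pr1 (pr2 u)) (pr2 (pr2 u)))"
    and refine: "\<And>m t j. R m t (j div 2) \<Longrightarrow> R m (Suc t) j"
    and card: "\<And>m t. card {j. j < 2 ^ t \<and> R m t j} * 2 ^ m \<le> 2 ^ t"
  obtains m where "\<And>t. \<not> R m t (cell_index z t)"
proof -
  define R' where "R' m t j \<longleftrightarrow> j < 2 ^ t \<and> R m t j" for m t j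
  define U where "U m = {0..1} \<inter> (\<Union>s. \<Union>k\<in>{k. R' m s k}. cell s k)" for m
  have "uniformly_effectively_open U" unfolding U_def R'_def
    by (intro uniformly_effectively_open_cells computable_intros dec)
  moreover have "measure lborel (U m) \<le> (1 / 2) ^ m" for m
  proof -
    \<comment> \<open>Half-open cells are used since they partition the line at each level. With
      open cells the union would lose midpoints at each refinement and would not increase.\<close>
    define H where "H t = (\<Union>k\<in>{k. R' m t k}. {real k / 2 ^ t ..< real (Suc k) / 2 ^ t})" for t
    have fin: "finite {k. R' m t k}" for t by (simp add: R'_def)
    have H_iff: "x \<in> H t \<longleftrightarrow> 0 \<le> x \<and> R' m t (cell_index x t)" for x t
    proof -
      have nonneg: "0 \<le> x" if "x \<in> H t"
      proof -
        obtain k where "real k / 2 ^ t \<le> x" using \<open>x \<in> H t\<close> unfolding H_def by auto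
        moreover have "0 \<le> real k / 2 ^ t" by simp
        ultimately show ?thesis by linarith
      qed
      moreover have "x \<in> H t \<longleftrightarrow> R' m t (cell_index x t)" if "0 \<le> x"
        using mem_half_open_cell_iff[OF that, of _ t] by (auto simp: H_def simp del: atLeastLessThan_iff)
      ultimately show ?thesis by blast
    qed
    have "H t \<subseteq> H (Suc t)" for t
    proof
      fix x assume "x \<in> H t"
      then have "0 \<le> x" "R' m t (cell_index x (Suc t) div 2)"
        using cell_index_div[of t "Suc t" x] by (auto simp: H_iff)
      then show "x \<in> H (Suc t)" using refine[of m t "cell_index x (Suc t)"]
        by (auto simp: H_iff R'_def)
    qed
    then have inc: "incseq H" by (rule incseq_SucI)
    have "H t \<in> sets borel" for t unfolding H_def using fin by auto
    then have H_borel: "range H \<subseteq> sets borel" by auto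
    have "emeasure lborel (H t) \<le> ennreal ((1 / 2) ^ m)" for t
    proof -
      have "real (card {k. R' m t k} * 2 ^ m) \<le> real (2 ^ t)"
        unfolding of_nat_le_iff R'_def by (rule card)
      then have "real (card {k. R' m t k}) / 2 ^ t \<le> (1 / 2) ^ m"
        by (simp add: field_simps)
      then show ?thesis unfolding H_def
        using emeasure_half_open_cells_le[OF fin, of t] by (meson ennreal_leI order_trans)
    qed
    then have "(SUP t. emeasure lborel (H t)) \<le> ennreal ((1 / 2) ^ m)" by (rule SUP_least)
    then have H: "emeasure lborel (\<Union>t. H t) \<le> ennreal ((1 / 2) ^ m)"
      using SUP_emeasure_incseq[of H lborel] inc H_borel by simp
    have "cell s k \<subseteq> {real k / 2 ^ s ..< real (Suc k) / 2 ^ s}" for s k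
      by (auto simp: cell_def)
    then have "U m \<subseteq> (\<Union>t. H t)" unfolding U_def H_def by blast
    then have "emeasure lborel (U m) \<le> emeasure lborel (\<Union>t. H t)" using H_borel by (intro emeasure_mono) auto
    then show ?thesis using H unfolding measure_def
      by (intro enn2real_leI) (auto intro: order_trans)
  qed
  ultimately obtain m where "z \<notin> U m" using ml(1) unfolding martin_loef_random_def by blast
  moreover have "z \<in> U m" if "R m t (cell_index z t)" for t
    using that cell_index_in_cell[OF ml, of t] martin_loef_random_bounds[OF ml]
      cell_index_less[of z t]
    unfolding U_def R'_def by auto
  ultimately show ?thesis using that by blast
qed

section \<open>Blocks of dyadic cells\<close>

lemma div_power_eq_iff: "j div 2 ^ d = k \<longleftrightarrow> j \<in> {k * 2 ^ d..<Suc k * 2 ^ d}" for j k :: nat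
proof -
  have "j div 2 ^ d = k \<longleftrightarrow> k \<le> j div 2 ^ d \<and> j div 2 ^ d < Suc k" by auto
  then show ?thesis
    by (simp only: less_eq_div_iff_mult_less_eq[OF zero_less_power[OF zero_less_numeral]]
        div_less_iff_less_mult[OF zero_less_power[OF zero_less_numeral]] atLeastLessThan_iff)
qed

lemma card_block: "card {j::nat. j div 2 ^ d = k} = 2 ^ d"
proof -
  have "{j::nat. j div 2 ^ d = k} = {k * 2 ^ d..<Suc k * 2 ^ d}"
    unfolding div_power_eq_iff by (rule Collect_mem_eq)
  then show ?thesis by simp
qed

lemma finite_block: "finite {j::nat. j div 2 ^ d = k}"
  unfolding div_power_eq_iff by simp

lemma div_power_div_power: "j div 2 ^ (t - u) div 2 ^ (u - a) = j div 2 ^ (t - a)"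
  if "a \<le> u" "u \<le> t" for j :: nat
  using that by (simp flip: div_mult2_eq power_add)

lemma div_power_less_iff: "j div 2 ^ (t - a) < 2 ^ a \<longleftrightarrow> j < 2 ^ t" if "a \<le> t" for j :: nat
proof -
  have "j div 2 ^ (t - a) < 2 ^ a \<longleftrightarrow> j < 2 ^ a * 2 ^ (t - a)"
    by (rule div_less_iff_less_mult) simp
  then show ?thesis using that by (simp flip: power_add)
qed

text \<open>Each string of length \<open>a\<close> has \<open>2 ^ (t - a)\<close> extensions of
  length \<open>t\<close>.\<close>

lemma card_refine:
  fixes Q :: "nat \<Rightarrow> bool"
  assumes "a \<le> t"
  shows "card {j. j < 2 ^ t \<and> Q (j div 2 ^ (t - a))} = card {k. k < 2 ^ a \<and> Q k} * 2 ^ (t - a)"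
proof -
  have "{j. j < 2 ^ t \<and> Q (j div 2 ^ (t - a))} =
      (\<Union>k\<in>{k. k < 2 ^ a \<and> Q k}. {j. j div 2 ^ (t - a) = k})"
    using div_power_less_iff[OF assms] by auto
  also have "card \<dots> = (\<Sum>k\<in>{k. k < 2 ^ a \<and> Q k}. card {j::nat. j div 2 ^ (t - a) = k})"
    by (rule card_UN_disjoint) (auto simp: finite_block)
  also have "\<dots> = card {k. k < 2 ^ a \<and> Q k} * 2 ^ (t - a)"
    by (simp only: card_block sum_constant of_nat_id)
  finally show ?thesis .
qed

section \<open>Iterated hits\<close>

text \<open>
  The number \<open>v\<close> codes a threshold \<open>K\<close> and a cell (see \<open>node\<close> below); it overflows at level \<open>t\<close> if
  \<open>D v\<close> holds on more than the fraction \<open>1 - 2 powr -K\<close> of the cell.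
\<close>

definition overflows :: "(nat \<Rightarrow> nat \<Rightarrow> nat \<Rightarrow> bool) \<Rightarrow> nat \<Rightarrow> nat \<Rightarrow> bool" where
  "overflows D v t \<longleftrightarrow> pr1 (pr2 v) \<le> t \<and>
     (2 ^ pr1 v - 1) * 2 ^ (t - pr1 (pr2 v)) < card {j. j < 2 ^ t \<and> D v t j} * 2 ^ pr1 v"

definition node :: "nat \<Rightarrow> nat \<Rightarrow> nat \<Rightarrow> nat" where
  "node K s k = prod_encode (K, prod_encode (s, k))"

lemma decidable_overflows:
  assumes D: "decidable_from A (\<lambda>u. D (pr1 u) (pr1 (pr2 u)) (pr2 (pr2 u)))"
    and "computable_from A f" "computable_from A g"
  shows "decidable_from A (\<lambda>u. overflows D (f u) (g u))"
proof -
  have "decidable_from A (\<lambda>u. overflows D (pr1 u) (pr2 u))" unfolding overflows_def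
    by (intro computable_intros decidable_comp3[OF D])
  from decidable_comp2[OF this assms(2,3)] show ?thesis .
qed

text \<open>Here \<open>b\<close> is the level of the current cell and \<open>a\<close> a later
  level. Requiring that the node has not overflowed by level \<open>a\<close> caps the hits at the
  fraction \<open>1 - 2 powr -K\<close> of the cell, even if the node overflows afterwards.\<close>

definition next_hit :: "(nat \<Rightarrow> nat \<Rightarrow> nat \<Rightarrow> bool) \<Rightarrow> nat \<Rightarrow> (nat \<Rightarrow> nat) \<Rightarrow> nat \<Rightarrow> nat \<Rightarrow> bool" where
  "next_hit D K x b a \<longleftrightarrow> D (node K b (x b)) a (x a) \<and> \<not> overflows D (node K b (x b)) a"

text \<open>Taking the first level after \<open>b\<close> makes the hit of each order unique, so the
  cells where hits of one order occur are disjoint.\<close>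

primrec hit :: "(nat \<Rightarrow> nat \<Rightarrow> nat \<Rightarrow> bool) \<Rightarrow> nat \<Rightarrow> (nat \<Rightarrow> nat) \<Rightarrow> nat \<Rightarrow> nat \<Rightarrow> bool" where
  "hit D K x 0 a \<longleftrightarrow> a = 0"
| "hit D K x (Suc m) a \<longleftrightarrow> (\<exists>b<a. hit D K x m b \<and> next_hit D K x b a \<and>
     (\<forall>a'<a. b < a' \<longrightarrow> \<not> next_hit D K x b a'))"

abbreviation prefixes :: "nat \<Rightarrow> nat \<Rightarrow> nat \<Rightarrow> nat" where
  "prefixes t j \<equiv> \<lambda>u. j div 2 ^ (t - u)"

text \<open>A hit at level \<open>a\<close> is determined by the prefixes up to level
  \<open>a\<close>, so it is a property of a finite string.\<close>

lemma hit_cong: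
  "(\<And>u. u \<le> a \<Longrightarrow> x u = y u) \<Longrightarrow> hit D K x m a \<longleftrightarrow> hit D K y m a"
proof (induction m arbitrary: a)
  case (Suc m)
  have nh: "next_hit D K x b a' \<longleftrightarrow> next_hit D K y b a'" if "b < a'" "a' \<le> a" for b a'
    using that Suc.prems by (simp add: next_hit_def)
  have "hit D K x m b \<longleftrightarrow> hit D K y m b" if "b < a" for b
    using that Suc.prems by (intro Suc.IH) auto
  then show ?case unfolding hit.simps using nh by (smt (verit) less_imp_le order_refl)
qed simp

lemma hit_unique: "hit D K x m a \<Longrightarrow> hit D K x m a' \<Longrightarrow> a = a'"
proof (induction m arbitrary: a a')
  case (Suc m)
  then obtain b b' where
    b: "b < a" "hit D K x m b" "next_hit D K x b a" "\<forall>c<a. b < c \<longrightarrow> \<not> next_hit D K x b c"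
    and b': "b' < a'" "hit D K x m b'" "next_hit D K x b' a'"
      "\<forall>c<a'. b' < c \<longrightarrow> \<not> next_hit D K x b' c"
    by auto
  have "b = b'" using Suc.IH b b' by blast
  then show ?case using b b' by (metis nat_neq_iff)
qed simp

text \<open>The hits of each order along a finite string are collected in the bits of a number, so that
  the recursion over the order becomes a recursion on numbers.\<close>

lemma decidable_hit:
  assumes D: "decidable_from A (\<lambda>u. D (pr1 u) (pr1 (pr2 u)) (pr2 (pr2 u)))"
    and m: "computable_from A m" and t: "computable_from A t" and j: "computable_from A j"
  shows "decidable_from A (\<lambda>u. \<exists>a<Suc (t u). hit D K (prefixes (t u) (j u)) (m u) a)"
proof -
  define step where "step t j F = (\<Sum>a<Suc t. (2::nat) ^ a * of_bool (\<exists>b<a. F div 2 ^ b mod 2 = 1 \<and>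
      next_hit D K (prefixes t j) b a \<and>
      (\<forall>a'<a. b < a' \<longrightarrow> \<not> next_hit D K (prefixes t j) b a')))" for t j F :: nat
  have bits: "(\<Sum>a<n. (2::nat) ^ a * of_bool (P a)) div 2 ^ i mod 2 = 1 \<longleftrightarrow> i < n \<and> P i" for P and n i :: nat
  proof -
    have "(\<Sum>a<n. 2 ^ a * of_bool (P a)) = set_encode {a. a < n \<and> P a}"
      unfolding set_encode_def by (simp add: sum.If_cases of_bool_def if_distrib Int_def cong: if_cong)
    moreover have "i \<in> set_decode (set_encode {a. a < n \<and> P a}) \<longleftrightarrow> i < n \<and> P i" by simp
    ultimately show ?thesis by (simp only: set_decode_def mem_Collect_eq odd_iff_mod_2_eq_one)
  qed
  \<comment> \<open>The start value 1 codes the set that contains only level 0, the level of the hit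
    of order 0.\<close>
  have hit: "(rec_nat 1 (\<lambda>_. step t j) m) div 2 ^ a mod 2 = 1 \<longleftrightarrow> hit D K (prefixes t j) m a"
    if "a \<le> t" for t j m a
    using that
  proof (induction m arbitrary: a)
    case 0
    have "a > 0 \<Longrightarrow> Suc 0 div 2 ^ a = 0" using one_less_power[of "2::nat" a] by simp
    then show ?case by (cases "a = 0") auto
  next
    case (Suc m)
    have "(rec_nat 1 (\<lambda>_. step t j) (Suc m)) div 2 ^ a mod 2 = 1 \<longleftrightarrow>
      (\<exists>b<a. rec_nat 1 (\<lambda>_. step t j) m div 2 ^ b mod 2 = 1 \<and>
      next_hit D K (prefixes t j) b a \<and>
      (\<forall>a'<a. b < a' \<longrightarrow> \<not> next_hit D K (prefixes t j) b a'))"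
      using Suc.prems unfolding old.nat.simps(7) by (subst step_def, subst bits) auto
    also have "\<dots> \<longleftrightarrow> hit D K (prefixes t j) (Suc m) a"
      using Suc.IH Suc.prems by auto
    finally show ?case .
  qed
  define F where "F u = rec_nat 1 (\<lambda>_. step (t u) (j u)) (m u)" for u
  have F: "computable_from A F" unfolding F_def step_def next_hit_def node_def
    by (intro computable_intros decidable_comp3[OF D] decidable_overflows[OF D] m
        computable_comp[OF m] computable_comp[OF j] computable_comp[OF t])
  have "decidable_from A (\<lambda>u. \<exists>a<Suc (t u). F u div 2 ^ a mod 2 = 1)"
    by (intro computable_intros t computable_comp[OF F])
  moreover have "(\<exists>a<Suc t. rec_nat 1 (\<lambda>_. step t j) m div 2 ^ a mod 2 = 1) \<longleftrightarrow>
      (\<exists>a<Suc t. hit D K (prefixes t j) m a)" for t j m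
    using hit by (metis less_Suc_eq_le)
  ultimately show ?thesis unfolding F_def by simp
qed

section \<open>Counting the iterated hits\<close>

text \<open>These are the two properties of denial that the measure estimates use: it takes place
  inside the cell of the node, and it persists under refinement.\<close>

locale monotone_hits =
  fixes D :: "nat \<Rightarrow> nat \<Rightarrow> nat \<Rightarrow> bool"
  assumes D_extends: "D (node K s k) t j \<Longrightarrow> s \<le> t \<and> j div 2 ^ (t - s) = k"
    and D_Suc: "D v t (j div 2) \<Longrightarrow> D v (Suc t) j"
begin

lemma D_mono: "D v t (j div 2 ^ (t' - t)) \<Longrightarrow> t \<le> t' \<Longrightarrow> D v t' j"
proof (induction "t' - t" arbitrary: t' j)
  case (Suc n)
  then obtain t'' where t'': "t' = Suc t''" "t \<le> t''" by (cases t') auto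
  then have "j div 2 ^ (t' - t) = (j div 2) div 2 ^ (t'' - t)"
    by (simp add: Suc_diff_le div_mult2_eq)
  then have "D v t'' (j div 2)" using Suc.hyps(1)[of t'' "j div 2"] Suc.hyps(2) Suc.prems t'' by simp
  then show ?case unfolding t'' by (rule D_Suc)
qed simp

text \<open>The fraction of the cell on which \<open>D v\<close> holds can only grow with the
  level.\<close>

lemma overflows_mono:
  assumes "overflows D v t" "t \<le> t'"
  shows "overflows D v t'"
proof -
  let ?s = "pr1 (pr2 v)"
  have s: "?s \<le> t" using assms(1) by (simp add: overflows_def)
  have "(2 ^ pr1 v - 1) * 2 ^ (t' - ?s) = ((2::nat) ^ pr1 v - 1) * 2 ^ (t - ?s) * 2 ^ (t' - t)"
    using s assms(2) by (simp add: mult.assoc flip: power_add)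
  also have "\<dots> < card {j. j < 2 ^ t \<and> D v t j} * 2 ^ pr1 v * 2 ^ (t' - t)"
    using assms(1) unfolding overflows_def by (intro mult_strict_right_mono) auto
  also have "\<dots> = card {j. j < 2 ^ t' \<and> D v t (j div 2 ^ (t' - t))} * 2 ^ pr1 v"
    using card_refine[OF assms(2), of "D v t"] by simp
  also have "\<dots> \<le> card {j. j < 2 ^ t' \<and> D v t' j} * 2 ^ pr1 v"
    by (intro mult_right_mono card_mono) (auto intro: D_mono assms(2))
  finally show ?thesis using s assms(2) unfolding overflows_def by simp
qed

text \<open>All hits can be moved to the last level up to \<open>t\<close> at which the node has not
  overflowed. There they lie in the part where \<open>D\<close> holds, which is still at most the
  fraction \<open>1 - 2 powr -K\<close> of the cell.\<close>

lemma card_hit_block: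
  assumes "a \<le> t" "k < 2 ^ a"
  shows "card {j. j div 2 ^ (t - a) = k \<and>
      (\<exists>u\<le>t. D (node K a k) u (j div 2 ^ (t - u)) \<and> \<not> overflows D (node K a k) u)} * 2 ^ K
    \<le> (2 ^ K - 1) * 2 ^ (t - a)" (is "card ?S * _ \<le> _")
proof (cases "?S = {}")
  case False
  let ?v = "node K a k"
  define V where "V = {u. a \<le> u \<and> u \<le> t \<and> \<not> overflows D ?v u}"
  have fin: "finite V" by (rule finite_subset[of _ "{..t}"]) (auto simp: V_def)
  have "V \<noteq> {}" using False D_extends unfolding V_def by blast
  then have "Max V \<in> V" using fin by simp
  then have w: "a \<le> Max V" "Max V \<le> t" "\<not> overflows D ?v (Max V)" by (auto simp: V_def)
  let ?w = "Max V"
  have "?S \<subseteq> {j. j < 2 ^ t \<and> D ?v ?w (j div 2 ^ (t - ?w))}"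
  proof (rule subsetI)
    fix j assume "j \<in> ?S"
    then obtain u where k: "j div 2 ^ (t - a) = k"
      and u: "u \<le> t" "D ?v u (j div 2 ^ (t - u))" "\<not> overflows D ?v u" by blast
    have "u \<in> V" using u D_extends[OF u(2)] by (auto simp: V_def)
    then have "u \<le> ?w" using fin by simp
    moreover have "D ?v u (j div 2 ^ (t - ?w) div 2 ^ (?w - u))"
      using u(2) w(2) \<open>u \<le> ?w\<close> by (simp add: div_power_div_power)
    ultimately have "D ?v ?w (j div 2 ^ (t - ?w))" by (intro D_mono[of ?v u "j div 2 ^ (t - ?w)" ?w])
    moreover have "j < 2 ^ t" using assms k div_power_less_iff by blast
    ultimately show "j \<in> {j. j < 2 ^ t \<and> D ?v ?w (j div 2 ^ (t - ?w))}" by simp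
  qed
  then have "card ?S \<le> card {j. j < 2 ^ t \<and> D ?v ?w (j div 2 ^ (t - ?w))}"
    by (intro card_mono) auto
  also have "\<dots> = card {j. j < 2 ^ ?w \<and> D ?v ?w j} * 2 ^ (t - ?w)"
    by (rule card_refine[OF w(2)])
  finally have "card ?S * 2 ^ K \<le> card {j. j < 2 ^ ?w \<and> D ?v ?w j} * 2 ^ K * 2 ^ (t - ?w)"
    by simp
  also have "\<dots> \<le> (2 ^ K - 1) * 2 ^ (?w - a) * 2 ^ (t - ?w)"
    using w(1,3) by (intro mult_right_mono) (auto simp: overflows_def node_def)
  also have "\<dots> = (2 ^ K - 1) * 2 ^ (t - a)"
    using w by (simp add: mult.assoc flip: power_add)
  finally show ?thesis .
qed (simp only: card.empty)

text \<open>By \<open>hit_unique\<close> the strings with a hit of order \<open>m\<close> split into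
  disjoint blocks, one for each cell where such a hit occurs. \<open>card_hit_block\<close> bounds
  the next hits inside each block.\<close>

lemma card_hit_Suc:
  "card {j. j < 2 ^ t \<and> (\<exists>a\<le>t. hit D K (prefixes t j) (Suc m) a)} * 2 ^ K
    \<le> (2 ^ K - 1) * card {j. j < 2 ^ t \<and> (\<exists>a\<le>t. hit D K (prefixes t j) m a)}"
proof -
  \<comment> \<open>\<open>Sig\<close> lists the cells with a hit of order \<open>m\<close> as pairs
    of level and index, \<open>Blk\<close> gives their descendants at level \<open>t\<close>, and
    \<open>Sub\<close> contains the descendants that have a next hit.\<close>
  define Sig where "Sig = (SIGMA a:{..t}. {k. k < 2 ^ a \<and> hit D K (prefixes a k) m a})"
  define Blk where "Blk = (\<lambda>(a, k). {j::nat. j div 2 ^ (t - a) = k})"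
  define Sub where "Sub = (\<lambda>(a, k). {j. j div 2 ^ (t - a) = k \<and>
      (\<exists>u\<le>t. D (node K a k) u (j div 2 ^ (t - u)) \<and> \<not> overflows D (node K a k) u)})"
  have fin: "finite Sig" unfolding Sig_def by auto
  have loc: "hit D K (prefixes t j) m a \<longleftrightarrow> hit D K (prefixes a (j div 2 ^ (t - a))) m a"
    if "a \<le> t" for j a
    using that by (intro hit_cong) (simp add: div_power_div_power)
  have "{j. j < 2 ^ t \<and> (\<exists>a\<le>t. hit D K (prefixes t j) m a)} = (\<Union>\<sigma>\<in>Sig. Blk \<sigma>)"
    unfolding Sig_def Blk_def using loc div_power_less_iff by fastforce
  also have "card \<dots> = (\<Sum>\<sigma>\<in>Sig. card (Blk \<sigma>))"
  proof (rule card_UN_disjoint[OF fin])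
    show "\<forall>\<sigma>\<in>Sig. finite (Blk \<sigma>)" by (auto simp: Blk_def finite_block)
    show "\<forall>\<sigma>\<in>Sig. \<forall>\<sigma>'\<in>Sig. \<sigma> \<noteq> \<sigma>' \<longrightarrow> Blk \<sigma> \<inter> Blk \<sigma>' = {}"
    proof (intro ballI impI, rule ccontr)
      fix \<sigma> \<sigma>' assume *: "\<sigma> \<in> Sig" "\<sigma>' \<in> Sig" "\<sigma> \<noteq> \<sigma>'" "Blk \<sigma> \<inter> Blk \<sigma>' \<noteq> {}"
      obtain a k a' k' where \<sigma>: "\<sigma> = (a, k)" "\<sigma>' = (a', k')" by (cases \<sigma>, cases \<sigma>') auto
      obtain j where j: "j div 2 ^ (t - a) = k" "j div 2 ^ (t - a') = k'"
        using *(4) unfolding \<sigma> Blk_def by auto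
      have "hit D K (prefixes t j) m a" "hit D K (prefixes t j) m a'"
        using *(1,2) loc[of a j] loc[of a' j] j unfolding \<sigma> Sig_def by auto
      then have "a = a'" by (rule hit_unique)
      then show False using * j \<sigma> by auto
    qed
  qed
  finally have N: "card {j. j < 2 ^ t \<and> (\<exists>a\<le>t. hit D K (prefixes t j) m a)} = (\<Sum>\<sigma>\<in>Sig. card (Blk \<sigma>))" .
  have "{j. j < 2 ^ t \<and> (\<exists>a\<le>t. hit D K (prefixes t j) (Suc m) a)} \<subseteq> (\<Union>\<sigma>\<in>Sig. Sub \<sigma>)"
  proof clarify
    fix j a assume j: "j < 2 ^ t" "a \<le> t" "hit D K (prefixes t j) (Suc m) a"
    then obtain b where b: "b < a" "hit D K (prefixes t j) m b" "next_hit D K (prefixes t j) b a"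
      by auto
    then have "(b, j div 2 ^ (t - b)) \<in> Sig"
      using j loc[of b j] div_power_less_iff[of b t j] unfolding Sig_def by auto
    moreover have "j \<in> Sub (b, j div 2 ^ (t - b))"
      using b(3) j(2) unfolding Sub_def next_hit_def by auto
    ultimately show "j \<in> (\<Union>\<sigma>\<in>Sig. Sub \<sigma>)" by blast
  qed
  moreover have fin_Sub: "finite (Sub \<sigma>)" for \<sigma>
    by (cases \<sigma>) (auto simp: Sub_def finite_block intro: finite_subset[OF _ finite_block])
  ultimately have "card {j. j < 2 ^ t \<and> (\<exists>a\<le>t. hit D K (prefixes t j) (Suc m) a)}
      \<le> card (\<Union>\<sigma>\<in>Sig. Sub \<sigma>)"
    using fin by (intro card_mono) auto
  also have "\<dots> \<le> (\<Sum>\<sigma>\<in>Sig. card (Sub \<sigma>))" by (rule card_UN_le[OF fin])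
  finally have "card {j. j < 2 ^ t \<and> (\<exists>a\<le>t. hit D K (prefixes t j) (Suc m) a)} * 2 ^ K
      \<le> (\<Sum>\<sigma>\<in>Sig. card (Sub \<sigma>)) * 2 ^ K" by simp
  also have "\<dots> = (\<Sum>\<sigma>\<in>Sig. card (Sub \<sigma>) * 2 ^ K)" by (rule sum_distrib_right)
  also have "\<dots> \<le> (\<Sum>\<sigma>\<in>Sig. (2 ^ K - 1) * card (Blk \<sigma>))"
  proof (rule sum_mono)
    fix \<sigma> assume "\<sigma> \<in> Sig"
    then obtain a k where "\<sigma> = (a, k)" "a \<le> t" "k < 2 ^ a" unfolding Sig_def by auto
    then show "card (Sub \<sigma>) * 2 ^ K \<le> (2 ^ K - 1) * card (Blk \<sigma>)"
      using card_hit_block[of a t k K] unfolding Sub_def Blk_def by (simp add: card_block)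
  qed
  also have "\<dots> = (2 ^ K - 1) * (\<Sum>\<sigma>\<in>Sig. card (Blk \<sigma>))" by (rule sum_distrib_left[symmetric])
  finally show ?thesis unfolding N .
qed

lemma card_hit:
  "card {j. j < 2 ^ t \<and> (\<exists>a\<le>t. hit D K (prefixes t j) m a)} * 2 ^ (K * m) \<le> (2 ^ K - 1) ^ m * 2 ^ t"
proof (induction m)
  case 0
  have "{j. j < 2 ^ t \<and> (\<exists>a\<le>t. hit D K (prefixes t j) 0 a)} = {..<2 ^ t}" by auto
  then show ?case by simp
next
  case (Suc m)
  let ?N = "\<lambda>m. card {j. j < 2 ^ t \<and> (\<exists>a\<le>t. hit D K (prefixes t j) m a)}"
  have "?N (Suc m) * 2 ^ (K * Suc m) = ?N (Suc m) * 2 ^ K * 2 ^ (K * m)" by (simp add: power_add)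
  also have "\<dots> \<le> (2 ^ K - 1) * ?N m * 2 ^ (K * m)" by (intro mult_right_mono card_hit_Suc) simp
  also have "\<dots> = (2 ^ K - 1) * (?N m * 2 ^ (K * m))" by simp
  also have "\<dots> \<le> (2 ^ K - 1) * ((2 ^ K - 1) ^ m * 2 ^ t)" by (intro mult_left_mono Suc.IH) simp
  finally show ?case by (simp only: power_Suc mult.assoc)
qed

end

section \<open>Density along the cells of a random real\<close>

lemma effectively_closed_borel:
  assumes "effectively_closed C"
  shows "C \<in> sets borel"
proof -
  obtain f :: "nat \<Rightarrow> nat" where f: "{0..1} - C = {0..1} \<inter> (\<Union>k. rat_interval (f k))" and C: "C \<subseteq> {0..1}"
    using assms unfolding effectively_closed_def effectively_open_def by blast
  have "open (\<Union>k. rat_interval (f k))"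
    by (intro open_UN) (auto simp: rat_interval_def split: prod.split)
  moreover have "C = {0..1} - (\<Union>k. rat_interval (f k))" using f C by blast
  ultimately show ?thesis by auto
qed

text \<open>Positive lower density bounds the density of \<open>C\<close> in all cells of
  \<open>z\<close> from some level \<open>s0\<close> on. The finitely many coarser cells contain the
  one at level \<open>s0\<close>, and \<open>K\<close> is chosen to serve both kinds.\<close>

lemma positive_density_cells:
  assumes ml: "martin_loef_random z" "z \<in> {0..1}"
    and dens: "positive_density_point z" and C: "effectively_closed C" "z \<in> C"
  obtains K where "\<And>s. 1 / 2 ^ K / 2 ^ s \<le> measure lborel
    ({real (cell_index z s) / 2 ^ s..real (Suc (cell_index z s)) / 2 ^ s} \<inter> C)"
proof -
  define I where "I s = {real (cell_index z s) / 2 ^ s..real (Suc (cell_index z s)) / 2 ^ s}" for s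
  have [measurable]: "C \<in> sets borel" by (rule effectively_closed_borel[OF C(1)])
  have "lower_density C z > 0" using dens C unfolding positive_density_point_def by blast
  then obtain e' where e': "0 < e'" "e' < lower_density C z" using dense by blast
  then obtain e where "e' = ereal e" by (cases e') auto
  then have e: "0 < e" "ereal e < lower_density C z" using e' by auto
  have "\<forall>\<^sub>F x in at_right 0 \<times>\<^sub>F at_right 0. ereal e <
     (\<lambda>(\<gamma>, \<delta>). ereal (measure lborel ({z - \<gamma>..z + \<delta>} \<inter> C) / (\<gamma> + \<delta>))) x"
    using e(2) unfolding lower_density_def by (rule less_LiminfD)
  then obtain P Q where PQ: "eventually P (at_right (0::real))" "eventually Q (at_right (0::real))"
    and ev: "\<And>\<gamma> \<delta>. P \<gamma> \<Longrightarrow> Q \<delta> \<Longrightarrow> e < measure lborel ({z - \<gamma>..z + \<delta>} \<inter> C) / (\<gamma> + \<delta>)"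
    unfolding eventually_prod_filter by auto
  obtain h1 h2 where h1: "0 < h1" "\<And>y. 0 < y \<Longrightarrow> y < h1 \<Longrightarrow> P y"
    and h2: "0 < h2" "\<And>y. 0 < y \<Longrightarrow> y < h2 \<Longrightarrow> Q y"
    using PQ unfolding eventually_at_right_field by auto
  obtain s0 where s0: "(1 / 2) ^ s0 < min h1 h2"
    using real_arch_pow_inv[of "min h1 h2" "1/2"] h1(1) h2(1) by auto
  have large: "e / 2 ^ s \<le> measure lborel (I s \<inter> C)" if "s0 \<le> s" for s
  proof -
    \<comment> \<open>With these radii the interval around \<open>z\<close> is the cell itself; both
      are positive because \<open>z\<close> lies in the open cell.\<close>
    let ?\<gamma> = "z - real (cell_index z s) / 2 ^ s" and ?\<delta> = "real (Suc (cell_index z s)) / 2 ^ s - z"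
    have pos: "0 < ?\<gamma>" "0 < ?\<delta>" using cell_index_in_cell[OF ml, of s] by (auto simp: cell_def)
    have sum: "?\<gamma> + ?\<delta> = 1 / 2 ^ s" by (simp add: field_simps)
    have "1 / 2 ^ s \<le> (1 / 2 :: real) ^ s0" using that
      by (simp add: power_one_over power_decreasing frac_le)
    then have "?\<gamma> < h1" "?\<delta> < h2" using pos sum s0 by linarith+
    then have "e < measure lborel ({z - ?\<gamma>..z + ?\<delta>} \<inter> C) / (?\<gamma> + ?\<delta>)"
      using pos h1(2) h2(2) by (intro ev) auto
    then have "e < measure lborel (I s \<inter> C) / (1 / 2 ^ s)"
      unfolding sum by (simp add: I_def)
    then show ?thesis by (simp add: field_simps)
  qed
  have small: "e / 2 ^ s0 \<le> measure lborel (I s \<inter> C)" if "s \<le> s0" for s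
  proof -
    have "I s0 \<subseteq> I s"
    proof -
      let ?d = "2 ^ (s0 - s) :: nat"
      have d: "cell_index z s0 div ?d = cell_index z s" by (rule cell_index_div[OF that])
      then have "cell_index z s * ?d \<le> cell_index z s0" "Suc (cell_index z s0) \<le> Suc (cell_index z s) * ?d"
        using div_power_eq_iff[of "cell_index z s0" "s0 - s" "cell_index z s"] by auto
      then have "real (cell_index z s) * ?d \<le> real (cell_index z s0)"
        "real (Suc (cell_index z s0)) \<le> real (Suc (cell_index z s)) * ?d"
        by (metis of_nat_le_iff of_nat_mult)+
      moreover have "(2::real) ^ s0 = 2 ^ s * ?d" using that by (simp flip: power_add)
      ultimately show ?thesis unfolding I_def by (auto simp: divide_simps mult_ac)
    qed
    then have "measure lborel (I s0 \<inter> C) \<le> measure lborel (I s \<inter> C)"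
    proof (intro measure_mono_fmeasurable)
      have "I s \<in> fmeasurable lborel" by (simp add: I_def fmeasurable_def emeasure_lborel_Icc_eq)
      then show "I s \<inter> C \<in> fmeasurable lborel" by (simp add: fmeasurable_Int_fmeasurable)
    qed (auto simp: I_def)
    then show ?thesis using large[of s0] by simp
  qed
  obtain K where K: "(1 / 2) ^ K < e / 2 ^ s0"
    using real_arch_pow_inv[of "e / 2 ^ s0" "1/2"] e(1) by auto
  have "1 / 2 ^ K / 2 ^ s \<le> measure lborel (I s \<inter> C)" for s
  proof (cases "s \<le> s0")
    case True
    have "1 / 2 ^ K / 2 ^ s \<le> (1 / 2 ^ K :: real)" by (simp add: divide_le_eq)
    also have "\<dots> \<le> e / 2 ^ s0" using K by (simp add: power_one_over)
    finally show ?thesis using small[OF True] by linarith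
  next
    case False
    have "e / 2 ^ s0 \<le> e" using e(1) by (simp add: divide_le_eq)
    then have "1 / 2 ^ K \<le> e" using K by (simp add: power_one_over)
    then have "1 / 2 ^ K / 2 ^ s \<le> e / 2 ^ s" by (intro divide_right_mono) auto
    then show ?thesis using large[of s] False by linarith
  qed
  then show ?thesis unfolding I_def by (rule that)
qed

section \<open>The class that loses density at overflowing nodes\<close>

context monotone_hits
begin

text \<open>Without overflow along \<open>z\<close>, the hypothesis \<open>reach\<close> produces
  hits of every order along \<open>z\<close>. But strings with many hits are rare by
  \<open>card_hit\<close>, and so a random \<open>z\<close> escapes them.\<close>

lemma overflow_if_reached:
  assumes ml: "martin_loef_random z" "z \<in> {0..1}"
    and D: "decidable_from {} (\<lambda>u. D (pr1 u) (pr1 (pr2 u)) (pr2 (pr2 u)))"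
    and reach: "\<And>s. \<exists>t. D (node K s (cell_index z s)) t (cell_index z t)"
  obtains s t where "overflows D (node K s (cell_index z s)) t"
proof -
  \<comment> \<open>\<open>L\<close> hits reduce the measure at least by half, so the hits of order
    \<open>m * L\<close> form the \<open>m\<close>-th component of a test.\<close>
  obtain L where L: "(2 ^ K - 1) ^ L * 2 \<le> (2::nat) ^ (K * L)"
  proof -
    let ?r = "(2 ^ K - 1) / (2::real) ^ K"
    obtain L where "?r ^ L < 1 / 2" using real_arch_pow_inv[of "1/2" ?r] by (auto simp: divide_less_eq)
    then have "(2 ^ K - 1) ^ L * 2 < (2::real) ^ (K * L)"
      by (simp add: power_divide divide_less_eq power_mult)
    then have "real ((2 ^ K - 1) ^ L * 2) < real (2 ^ (K * L))" by (simp add: of_nat_diff)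
    then show ?thesis using that by (metis less_imp_le of_nat_less_iff)
  qed
  define R where "R m t j \<longleftrightarrow> (\<exists>a<Suc t. hit D K (prefixes t j) (m * L) a)" for m t j
  have "decidable_from {} (\<lambda>u. R (pr1 u) (pr1 (pr2 u)) (pr2 (pr2 u)))"
    unfolding R_def by (intro decidable_hit[OF D] computable_intros)
  moreover have "R m (Suc t) j" if R: "R m t (j div 2)" for m t j
  proof -
    obtain a where a: "a \<le> t" "hit D K (prefixes t (j div 2)) (m * L) a"
      using R unfolding R_def by (auto simp: less_Suc_eq_le)
    have "j div 2 div 2 ^ (t - u) = j div 2 ^ (Suc t - u)" if "u \<le> a" for u
      using that a(1) by (simp add: Suc_diff_le div_mult2_eq)
    then have "hit D K (prefixes (Suc t) j) (m * L) a"
      using a(2) hit_cong[of a "prefixes t (j div 2)" "prefixes (Suc t) j"] by simp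
    then show ?thesis using a(1) unfolding R_def by (auto simp: less_Suc_eq_le intro!: exI[of _ a])
  qed
  moreover have "card {j. j < 2 ^ t \<and> R m t j} * 2 ^ m \<le> 2 ^ t" for m t
  proof -
    let ?N = "card {j. j < 2 ^ t \<and> R m t j}"
    have N: "?N * 2 ^ (K * (m * L)) \<le> (2 ^ K - 1) ^ (m * L) * 2 ^ t"
      using card_hit[of t K "m * L"] unfolding R_def less_Suc_eq_le .
    have "(2 ^ K - 1) ^ (m * L) * (2::nat) ^ m = ((2 ^ K - 1) ^ L * 2) ^ m"
      by (simp add: power_mult_distrib mult.commute[of m] flip: power_mult)
    also have "\<dots> \<le> ((2::nat) ^ (K * L)) ^ m" by (intro power_mono L) simp
    also have "\<dots> = 2 ^ (K * (m * L))" by (simp add: mult_ac flip: power_mult)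
    finally have p: "(2 ^ K - 1) ^ (m * L) * 2 ^ m \<le> (2::nat) ^ (K * (m * L))" .
    have "?N * 2 ^ m * 2 ^ (K * (m * L)) = ?N * 2 ^ (K * (m * L)) * 2 ^ m" by simp
    also have "\<dots> \<le> (2 ^ K - 1) ^ (m * L) * 2 ^ t * 2 ^ m" by (intro mult_right_mono N) simp
    also have "\<dots> = (2 ^ K - 1) ^ (m * L) * 2 ^ m * 2 ^ t" by simp
    also have "\<dots> \<le> 2 ^ (K * (m * L)) * 2 ^ t" by (intro mult_right_mono p) simp
    finally show ?thesis by simp
  qed
  ultimately obtain m where m: "\<And>t. \<not> R m t (cell_index z t)"
    using martin_loef_random_escapes[OF ml] by blast
  show ?thesis
  proof (rule ccontr)
    assume "\<not> thesis"
    then have no: "\<not> overflows D (node K s (cell_index z s)) t" for s t using that by blast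
    have "\<exists>a. hit D K (cell_index z) n a" for n
    proof (induction n)
      case (Suc n)
      then obtain b where b: "hit D K (cell_index z) n b" by blast
      obtain t where t: "D (node K b (cell_index z b)) t (cell_index z t)" using reach by blast
      then have "b < Suc t" using D_extends by (simp add: less_Suc_eq_le)
      \<comment> \<open>The level \<open>t\<close> may equal \<open>b\<close>, whereas a hit must
        lie strictly beyond \<open>b\<close>; hence one more refinement.\<close>
      have "D (node K b (cell_index z b)) (Suc t) (cell_index z (Suc t))"
        using t cell_index_div[of t "Suc t" z] by (intro D_Suc) simp
      then have ex: "b < Suc t \<and> next_hit D K (cell_index z) b (Suc t)"
        using no \<open>b < Suc t\<close> by (simp add: next_hit_def)
      define a where "a = (LEAST a. b < a \<and> next_hit D K (cell_index z) b a)"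
      have "b < a \<and> next_hit D K (cell_index z) b a" 
        unfolding a_def using ex by (rule LeastI[where P="\<lambda>a. b < a \<and> next_hit D K (cell_index z) b a"])
      moreover have "\<not> next_hit D K (cell_index z) b a'" if "a' < a" "b < a'" for a'
        using not_less_Least[of a'] that unfolding a_def by blast
      ultimately show ?case using b by auto
    qed auto
    then obtain a where a: "hit D K (cell_index z) (m * L) a" by blast
    have "hit D K (prefixes a (cell_index z a)) (m * L) a"
      using a hit_cong[of a "cell_index z" "prefixes a (cell_index z a)"] by (simp add: cell_index_div)
    then show False using m[of a] unfolding R_def by blast
  qed
qed

text \<open>The bound \<open>v < t\<close> makes this decidable. Overflow and \<open>D\<close>
  persist to higher levels, so each overflowing node takes effect from some level on.\<close>

definition removed :: "nat \<Rightarrow> nat \<Rightarrow> bool" where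
  "removed t j \<longleftrightarrow> (\<exists>v<t. overflows D v t \<and> D v t j)"

text \<open>At a sufficiently high level the descendants satisfying \<open>D\<close> are removed,
  and fewer than the fraction \<open>2 powr -K\<close> of the descendants remain.\<close>

lemma measure_overflowing_cell:
  assumes "overflows D (node K s k) t"
  shows "measure lborel ({real k / 2 ^ s..real (Suc k) / 2 ^ s} \<inter>
      ({0..1} - (\<Union>t. \<Union>j\<in>{j. removed t j}. cell t j))) < 1 / 2 ^ K / 2 ^ s"
    (is "measure lborel (?I \<inter> ?C) < _")
proof -
  let ?v = "node K s k"
  \<comment> \<open>The level is past the overflow and also past the number of the node, as
    \<open>removed\<close> demands.\<close>
  define T where "T = max t (Suc ?v)"
  have ov: "overflows D ?v T" using overflows_mono[OF assms] by (simp add: T_def)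
  then have s: "s \<le> T" by (simp add: overflows_def node_def)
  then have T_eq: "(2::real) ^ T = 2 ^ s * 2 ^ (T - s)" by (simp flip: power_add)
  define G where "G = {j. j div 2 ^ (T - s) = k \<and> D ?v T j}"
  define J where "J = {j. j div 2 ^ (T - s) = k \<and> \<not> D ?v T j}"
  have fin: "finite G" "finite J"
    by (rule finite_subset[OF _ finite_block[of "T - s" k]]; auto simp: G_def J_def)+
  have "card G + card J = card (G \<union> J)"
    using fin by (intro card_Un_disjoint[symmetric]) (auto simp: G_def J_def)
  also have "G \<union> J = {j. j div 2 ^ (T - s) = k}" by (auto simp: G_def J_def)
  finally have GJ: "card G + card J = 2 ^ (T - s)" by (simp add: card_block)
  have "(2 ^ K - 1) * 2 ^ (T - s) < card {j. j < 2 ^ T \<and> D ?v T j} * 2 ^ K"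
    using ov by (simp add: overflows_def node_def)
  also have "\<dots> \<le> card G * 2 ^ K"
    using fin D_extends by (intro mult_right_mono card_mono) (auto simp: G_def)
  finally have G: "2 ^ K * 2 ^ (T - s) < card G * 2 ^ K + 2 ^ (T - s)"
    by (simp add: diff_mult_distrib)
  have "card J * 2 ^ K < 2 ^ (T - s)"
    using G unfolding GJ[symmetric] by (simp add: algebra_simps)
  then have "real (card J * 2 ^ K) < real (2 ^ (T - s))" unfolding of_nat_less_iff .
  then have "real (card J) * 2 ^ K < 2 ^ (T - s)" by simp
  then have J: "card J / 2 ^ T < 1 / 2 ^ K / 2 ^ s"
    unfolding T_eq by (simp add: field_simps)
  \<comment> \<open>Removal concerns open cells, so grid points of level \<open>T\<close> may
    survive. They form a finite null set.\<close>
  define F where "F = (\<lambda>i. real i / 2 ^ T) ` {..2 ^ T}"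
  have F_I: "real i / 2 ^ T \<in> F" if "i \<le> 2 ^ T" for i using that by (auto simp: F_def)
  have rem: "cell T j \<inter> ?C = {}" if "j \<in> G" for j
  proof -
    have "?v < T" by (simp add: T_def)
    then have "removed T j" using that ov unfolding removed_def G_def by blast
    then show ?thesis by blast
  qed
  have "?I \<inter> ?C \<subseteq> (\<Union>j\<in>J. {real j / 2 ^ T ..< real (Suc j) / 2 ^ T}) \<union> F"
  proof
    fix x assume x: "x \<in> ?I \<inter> ?C"
    then have x01: "0 \<le> x" "x \<le> 1" by auto
    show "x \<in> (\<Union>j\<in>J. {real j / 2 ^ T ..< real (Suc j) / 2 ^ T}) \<union> F"
    proof (cases "x \<in> F")
      case False
      let ?j = "cell_index x T"
      have "x \<noteq> 1" using False unfolding F_def by force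
      then have j_less: "?j < 2 ^ T" using x01 by (intro cell_index_less) auto
      have b: "real ?j / 2 ^ T \<le> x" "x < real (Suc ?j) / 2 ^ T"
        using cell_index_bounds[OF x01(1)] by auto
      have "real ?j / 2 ^ T \<noteq> x" using False F_I[of ?j] j_less by auto
      then have "x \<in> cell T ?j" using b by (simp add: cell_def)
      \<comment> \<open>The right endpoint of the closed cell belongs to the next half-open cell,
        but it is a grid point and so already lies in \<open>F\<close>.\<close>
      have "x \<noteq> real (Suc k) / 2 ^ s"
      proof
        assume xk: "x = real (Suc k) / 2 ^ s"
        define N where "N = Suc k * 2 ^ (T - s)"
        have "real N = real (Suc k) * 2 ^ (T - s)"
          by (simp only: N_def of_nat_mult of_nat_power of_nat_numeral)
        then have eq: "x = real N / 2 ^ T" using xk by (simp add: T_eq)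
        then have "real N \<le> real (2 ^ T)" using x01 by (simp add: divide_le_eq)
        then have "N \<le> 2 ^ T" unfolding of_nat_le_iff .
        then show False using False F_I eq by metis
      qed
      then have "cell_index x s = k"
        using x mem_half_open_cell_iff[OF x01(1), of k s] by auto
      then have "?j div 2 ^ (T - s) = k" using cell_index_div[OF s, of x] by simp
      moreover have "?j \<notin> G" using rem \<open>x \<in> cell T ?j\<close> x by blast
      ultimately have "?j \<in> J" by (auto simp: G_def J_def)
      then show ?thesis using b by auto
    qed simp
  qed
  moreover have "finite F" by (simp add: F_def)
  then have F: "F \<in> sets lborel" "emeasure lborel F = 0"
    by (auto simp: borel_closed finite_imp_closed intro!: emeasure_lborel_countable countable_finite)
  moreover have U: "(\<Union>j\<in>J. {real j / 2 ^ T ..< real (Suc j) / 2 ^ T}) \<in> sets lborel"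
    using fin by (intro sets.finite_UN) auto
  ultimately have "emeasure lborel (?I \<inter> ?C) \<le>
      emeasure lborel ((\<Union>j\<in>J. {real j / 2 ^ T ..< real (Suc j) / 2 ^ T}) \<union> F)"
    by (intro emeasure_mono sets.Un)
  also have "\<dots> \<le> emeasure lborel (\<Union>j\<in>J. {real j / 2 ^ T ..< real (Suc j) / 2 ^ T}) + emeasure lborel F"
    by (intro emeasure_subadditive F U)
  also have "emeasure lborel F = 0" by (rule F)
  finally have "emeasure lborel (?I \<inter> ?C) \<le> ennreal (card J / 2 ^ T)"
    using emeasure_half_open_cells_le[OF fin(2), of T] by simp
  then have "measure lborel (?I \<inter> ?C) \<le> card J / 2 ^ T"
    unfolding measure_def by (intro enn2real_leI) auto
  then show ?thesis using J by linarith
qed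

text \<open>By \<open>avoid\<close>, \<open>z\<close> stays in the class left after removal.
  Positive density there would exclude overflow at the nodes of \<open>z\<close> for one
  \<open>K\<close>; then \<open>reach\<close> applies to all of them and
  \<open>overflow_if_reached\<close> gives a contradiction.\<close>

lemma not_positive_density_point:
  assumes ml: "martin_loef_random z" "z \<in> {0..1}"
    and D: "decidable_from {} (\<lambda>u. D (pr1 u) (pr1 (pr2 u)) (pr2 (pr2 u)))"
    and avoid: "\<And>v t t'. overflows D v t \<Longrightarrow> \<not> D v t' (cell_index z t')"
    and reach: "\<And>K s. (\<And>t. \<not> overflows D (node K s (cell_index z s)) t) \<Longrightarrow>
        \<exists>t. D (node K s (cell_index z s)) t (cell_index z t)"
  shows "\<not> positive_density_point z"
proof
  assume dens: "positive_density_point z"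
  let ?C = "{0..1} - (\<Union>t. \<Union>j\<in>{j. removed t j}. cell t j)"
  have "decidable_from {} (\<lambda>u. removed (pr1 u) (pr2 u))" unfolding removed_def
    by (intro computable_intros decidable_overflows[OF D] decidable_comp3[OF D])
  from effectively_open_cells[OF this] have C: "effectively_closed ?C"
    unfolding effectively_closed_def by (auto simp: Diff_Diff_Int)
  have "z \<notin> cell t j" if "removed t j" for t j
  proof
    assume "z \<in> cell t j"
    then have "cell_index z t = j"
      using mem_half_open_cell_iff[of z j t] ml(2) by (auto simp: cell_def)
    then show False using that avoid unfolding removed_def by blast
  qed
  then have "z \<in> ?C" using ml(2) by blast
  obtain K where K: "\<And>s. 1 / 2 ^ K / 2 ^ s \<le> measure lborel
      ({real (cell_index z s) / 2 ^ s..real (Suc (cell_index z s)) / 2 ^ s} \<inter> ?C)"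
    by (rule positive_density_cells[OF ml dens C \<open>z \<in> ?C\<close>]) (rule that)
  have no: "\<not> overflows D (node K s (cell_index z s)) t" for s t
    using measure_overflowing_cell[of K s "cell_index z s" t] K[of s] by linarith
  have "\<exists>t. D (node K s (cell_index z s)) t (cell_index z t)" for s
    by (rule reach[OF no])
  from overflow_if_reached[OF ml D this] show False using no by metis
qed

end

section \<open>Programs for the halting set\<close>

lemma program_encode_inject: "program_encode p = program_encode q \<Longrightarrow> p = q"
proof (induction p arbitrary: q)
  case Zero then show ?case by (cases q) auto
next
  case Succ then show ?case by (cases q) auto
next
  case Fst then show ?case by (cases q) auto
next
  case Snd then show ?case by (cases q) auto
next
  case Query then show ?case by (cases q) auto
next
  case (PairOf p1 p2) 
  then show ?case by (cases q; simp; presburger)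
next
  case (Comp p1 p2) 
  then show ?case by (cases q; simp; presburger)
next
  case (PrimRec p1 p2) 
  then show ?case by (cases q; simp; presburger)
next
  case (Mu p1) 
  then show ?case by (cases q; simp; presburger)
qed

lemma program_encode_surj: "\<exists>p. program_encode p = n"
proof (induction n rule: less_induct)
  case (less n)
  show ?case
  proof (cases "n < 5")
    case True
    then have "n \<in> {program_encode Zero, program_encode Succ, program_encode Fst,
        program_encode Snd, program_encode Query}" by auto
    then show ?thesis by blast
  next
    case False
    define c r where "c = (n - 5) div 4" and "r = (n - 5) mod 4"
    have n: "n = 5 + r + 4 * c" using False by (simp add: c_def r_def)
    have "r < 4" by (simp add: r_def)
    have "pr1 c \<le> c" "pr2 c \<le> c"
      by (metis le_prod_encode_1 le_prod_encode_2 prod.collapse prod_decode_inverse)+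
    then obtain p q where pq: "program_encode p = pr1 c" "program_encode q = pr2 c"
      using less[of "pr1 c"] less[of "pr2 c"] n by auto
    obtain p' where "program_encode p' = c" using less[of c] n by auto
    then have "n \<in> {program_encode (PairOf p q), program_encode (Comp p q),
        program_encode (PrimRec p q), program_encode (Mu p')}"
      using n pq \<open>r < 4\<close> by auto
    then show ?thesis by blast
  qed
qed

lemma mem_turing_jump_iff: "program_encode p \<in> turing_jump A \<longleftrightarrow> (\<exists>y. runs A p (program_encode p) y)"
  unfolding turing_jump_def using program_encode_inject by blast

text \<open>The number 0 is a string of zeros, a prefix of the empty oracle. This is the stage
  \<open>s\<close> approximation of the halting set.\<close>

definition halts :: "nat \<Rightarrow> nat \<Rightarrow> bool" where
  "halts e s \<longleftrightarrow> (\<exists>y<s. sim s 0 e e y)"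

lemma decidable_halts:
  assumes "computable_from A f" "computable_from A g"
  shows "decidable_from A (\<lambda>u. halts (f u) (g u))"
  unfolding halts_def
  by (intro computable_intros decidable_sim computable_comp[OF assms(1)] computable_comp[OF assms(2)] assms)

lemma halts_mono: "halts e s \<Longrightarrow> s \<le> s' \<Longrightarrow> halts e s'"
  unfolding halts_def using sim_extend[of s 0 s' e e] by (auto intro: less_le_trans)

lemma mem_turing_jump_iff_halts: "e \<in> turing_jump {} \<longleftrightarrow> (\<exists>s. halts e s)"
proof -
  obtain p where p: "e = program_encode p" using program_encode_surj by metis
  show ?thesis unfolding p mem_turing_jump_iff
  proof
    assume "\<exists>y. runs {} p (program_encode p) y"
    then obtain y where "runs {} p (program_encode p) y" by blast
    then obtain s where s: "\<And>s' k. s' \<ge> s \<Longrightarrow> agrees {} s' k \<Longrightarrow> sim s' k (program_encode p) (program_encode p) y"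
      using sim_complete by metis
    have "halts (program_encode p) (max s (Suc y))" unfolding halts_def
      using s[OF _ agrees_empty, of "max s (Suc y)"] by (intro exI[of _ y]) auto
    then show "\<exists>s. halts (program_encode p) s" by blast
  next
    assume "\<exists>s. halts (program_encode p) s"
    then show "\<exists>y. runs {} p (program_encode p) y"
      unfolding halts_def using sim_sound[OF _ agrees_empty] by blast
  qed
qed

lemma semidecidable_program:
  assumes "decidable_from A (\<lambda>u. P (pr1 u) (pr2 u))"
  obtains q where "\<And>x. (\<exists>y. runs A q x y) \<longleftrightarrow> (\<exists>n. P x n)"
proof -
  obtain p where p: "\<And>u. runs A p u (of_bool (\<not> P (pr1 u) (pr2 u)))"
    using decidable_not[OF assms] unfolding decidable_from_def computable_from_def by blast
  have "(\<exists>y. runs A (Mu p) x y) \<longleftrightarrow> (\<exists>n. P x n)" for x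
  proof
    assume "\<exists>y. runs A (Mu p) x y"
    then obtain n where "runs A p (prod_encode (x, n)) 0" by (auto elim: runs.cases)
    from runs_deterministic[OF this p] show "\<exists>n. P x n" by (auto split: if_splits)
  next
    assume ex: "\<exists>n. P x n"
    have "runs A (Mu p) x (LEAST n. P x n)" using p ex by (rule runs_Mu_Least)
    then show "\<exists>y. runs A (Mu p) x y" by blast
  qed
  then show ?thesis by (rule that)
qed

primrec const_program :: "nat \<Rightarrow> program" where
  "const_program 0 = Zero"
| "const_program (Suc n) = Comp Succ (const_program n)"

lemma runs_const_program: "runs A (const_program n) x n"
  by (induction n) (auto intro: runs.intros)

lemma computable_const_program:
  assumes "computable_from A f"
  shows "computable_from A (\<lambda>u. program_encode (const_program (f u)))"
proof -
  \<comment> \<open>The inner 1 is the number of \<open>Succ\<close>, and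
    \<open>6 + 4 * prod_encode (1, y)\<close> that of a composition with it.\<close>
  have "rec_nat 0 (\<lambda>_ y. 6 + 4 * prod_encode (1, y)) n = program_encode (const_program n)" for n
    by (induction n) auto
  moreover have "computable_from A (\<lambda>u. rec_nat 0 (\<lambda>_ y. 6 + 4 * prod_encode (1, y)) (f u))"
    by (intro computable_intros assms)
  ultimately show ?thesis by simp
qed

text \<open>A program that applies \<open>c\<close> to the pair of \<open>c\<close> itself and \<open>v\<close>, whatever its input; this takes
  the place of the recursion theorem.\<close>

definition self_application :: "nat \<Rightarrow> nat \<Rightarrow> nat" where
  "self_application c v =
     6 + 4 * prod_encode (c, program_encode (const_program (prod_encode (c, v))))"

text \<open>The constant subprogram ignores its input, so running the program on its own number
  amounts to running \<open>p\<close> on the prepared pair.\<close>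

lemma self_application_mem_jump_iff:
  "self_application (program_encode p) v \<in> turing_jump {} \<longleftrightarrow>
     (\<exists>y. runs {} p (prod_encode (program_encode p, v)) y)"
proof -
  let ?q = "const_program (prod_encode (program_encode p, v))"
  have "self_application (program_encode p) v = program_encode (Comp p ?q)"
    by (simp add: self_application_def)
  moreover have "runs {} (Comp p ?q) x y \<longleftrightarrow> runs {} p (prod_encode (program_encode p, v)) y" for x y
  proof
    assume "runs {} (Comp p ?q) x y"
    then show "runs {} p (prod_encode (program_encode p, v)) y"
      by cases (metis runs_const_program runs_deterministic)
  qed (rule runs_Comp[OF runs_const_program])
  ultimately show ?thesis by (simp only: mem_turing_jump_iff)
qed

section \<open>Random reals computing the halting problem\<close>

text \<open>The output 0 is the answer that the number attached to the node \<open>v\<close> lies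
  outside the halting set. The parameter \<open>c\<close> is the number of the program that controls
  these memberships.\<close>

definition denies :: "program \<Rightarrow> nat \<Rightarrow> nat \<Rightarrow> nat \<Rightarrow> nat \<Rightarrow> bool" where
  "denies G c v t j \<longleftrightarrow> pr1 (pr2 v) \<le> t \<and> j div 2 ^ (t - pr1 (pr2 v)) = pr2 (pr2 v) \<and>
     sim t j (program_encode G) (self_application c v) 0"

lemma monotone_hits_denies: "monotone_hits (denies G c)"
proof
  fix K s k t j
  show "denies G c (node K s k) t j \<Longrightarrow> s \<le> t \<and> j div 2 ^ (t - s) = k"
    by (simp add: denies_def node_def)
next
  fix v t j
  assume *: "denies G c v t (j div 2)"
  then have "j div 2 ^ (Suc t - pr1 (pr2 v)) = pr2 (pr2 v)"
    by (simp add: denies_def Suc_diff_le div_mult2_eq)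
  then show "denies G c v (Suc t) j"
    using * sim_extend[of t j "Suc t"] by (simp add: denies_def)
qed

lemma decidable_denies:
  assumes "computable_from A c" "computable_from A v" "computable_from A t" "computable_from A j"
  shows "decidable_from A (\<lambda>u. denies G (c u) (v u) (t u) (j u))"
  unfolding denies_def self_application_def
  by (intro computable_intros decidable_sim computable_const_program assms)

lemma computes_jump_imp_not_positive_density:
  assumes ml: "martin_loef_random z" "z \<in> {0..1}"
    and comp: "turing_computes (binary_expansion z) (turing_jump {})"
  shows "\<not> positive_density_point z"
proof -
  obtain G where G: "\<And>x. runs (binary_expansion z) G x (of_bool (x \<in> turing_jump {}))"
    using comp unfolding turing_computes_def by blast
  have agr: "agrees (binary_expansion z) s (cell_index z s)" for s
    using ml(2) by (intro agrees_cell_index) simp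
  \<comment> \<open>The control number is part of the input here, because the program found from
    this fact is to be applied to its own number.\<close>
  have "decidable_from {} (\<lambda>u. overflows (denies G (pr1 (pr1 u))) (pr2 (pr1 u)) (pr2 u))"
    unfolding overflows_def by (intro computable_intros decidable_denies)
  then obtain P where P: "\<And>x. (\<exists>y. runs {} P x y) \<longleftrightarrow> (\<exists>t. overflows (denies G (pr1 x)) (pr2 x) t)"
    by (rule semidecidable_program[of "{}" "\<lambda>x t. overflows (denies G (pr1 x)) (pr2 x) t"]) (rule that)
  define c where "c = program_encode P"
  \<comment> \<open>Setting \<open>c\<close> to the number of \<open>P\<close> closes the circle: a
    node's number enters the halting set exactly if the node overflows, where overflow refers to
    these same numbers.\<close>
  have jump: "self_application c v \<in> turing_jump {} \<longleftrightarrow> (\<exists>t. overflows (denies G c) v t)" for v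
    unfolding c_def self_application_mem_jump_iff P by simp
  interpret monotone_hits "denies G c" by (rule monotone_hits_denies)
  show ?thesis
  proof (rule not_positive_density_point[OF ml])
    show "decidable_from {} (\<lambda>u. denies G c (pr1 u) (pr1 (pr2 u)) (pr2 (pr2 u)))"
      by (intro decidable_denies computable_intros)
  next
    fix v t t' assume "overflows (denies G c) v t"
    then have "self_application c v \<in> turing_jump {}" using jump by blast
    \<comment> \<open>\<open>G\<close> is correct with oracle \<open>z\<close>, so it accepts the
      number put in; by determinism no prefix of \<open>z\<close> can deny it.\<close>
    then have "runs (binary_expansion z) G (self_application c v) 1"
      using G[of "self_application c v"] by simp
    then have "\<not> runs (binary_expansion z) G (self_application c v) 0"
      using runs_deterministic by fastforce
    then show "\<not> denies G c v t' (cell_index z t')"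
      unfolding denies_def using sim_sound agr by blast
  next
    fix K s assume no: "\<And>t. \<not> overflows (denies G c) (node K s (cell_index z s)) t"
    let ?v = "node K s (cell_index z s)"
    have "self_application c ?v \<notin> turing_jump {}" using no jump by blast
    then have "runs (binary_expansion z) G (self_application c ?v) 0"
      using G[of "self_application c ?v"] by simp
    then obtain t where t: "\<And>t' k. t' \<ge> t \<Longrightarrow> agrees (binary_expansion z) t' k \<Longrightarrow>
        sim t' k (program_encode G) (self_application c ?v) 0"
      by (rule sim_complete) (rule that)
    have "denies G c ?v (max s t) (cell_index z (max s t))"
      using t[OF _ agr, of "max s t"] cell_index_div[of s "max s t" z] by (simp add: denies_def node_def)
    then show "\<exists>t. denies G c ?v t (cell_index z t)" by blast
  qed
qed

section \<open>Stages of an effectively closed class\<close>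

text \<open>
  Under the numbering of the integers, \<open>n\<close> stands for a number with absolute value \<open>(n + 1) div 2\<close>
  and with sign given by its parity; the denominator 0 makes the rational 0.
\<close>

definition rat_less_dyadic :: "nat \<Rightarrow> nat \<Rightarrow> nat \<Rightarrow> bool" where
  "rat_less_dyadic a s k \<longleftrightarrow>
    (if pr1 a mod 2 = pr2 a mod 2
     then (if pr2 a = 0 then 0 < k
       else (pr1 a + 1) div 2 * 2 ^ s < k * ((pr2 a + 1) div 2))
     else 0 < k \<or> 0 < pr1 a \<and> 0 < pr2 a)"

definition dyadic_less_rat :: "nat \<Rightarrow> nat \<Rightarrow> nat \<Rightarrow> bool" where
  "dyadic_less_rat s k a \<longleftrightarrow> pr1 a mod 2 = pr2 a mod 2 \<and> 0 < pr2 a \<and>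
     k * ((pr2 a + 1) div 2) < (pr1 a + 1) div 2 * 2 ^ s"

lemma int_decode_eq_abs:
  "real_of_int (int_decode n) = (if even n then 1 else -1) * real ((n + 1) div 2)"
  by (auto simp: int_decode_def sum_decode_def elim!: oddE evenE)

lemma real_of_rat_nat_to_rat_surj:
  "real_of_rat (nat_to_rat_surj a) = (if pr1 a mod 2 = pr2 a mod 2 then 1 else -1) *
     (real ((pr1 a + 1) div 2) / real ((pr2 a + 1) div 2))"
proof -
  have "nat_to_rat_surj a = Fract (int_decode (pr1 a)) (int_decode (pr2 a))"
    by (simp add: nat_to_rat_surj_def split: prod.split)
  then have "real_of_rat (nat_to_rat_surj a) = int_decode (pr1 a) / int_decode (pr2 a)"
    by (cases "int_decode (pr2 a) = 0") (simp_all add: of_rat_rat rat_number_collapse)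
  moreover have "pr1 a mod 2 = pr2 a mod 2 \<longleftrightarrow> even (pr1 a) = even (pr2 a)"
    by (simp add: mod2_eq_if)
  moreover define n d where "n = real ((pr1 a + 1) div 2)" and "d = real ((pr2 a + 1) div 2)"
  ultimately show ?thesis unfolding int_decode_eq_abs n_def[symmetric] d_def[symmetric]
    by (cases "even (pr1 a)"; cases "even (pr2 a)"; simp)
qed

lemma rat_less_dyadic_iff:
  "rat_less_dyadic a s k \<longleftrightarrow> real_of_rat (nat_to_rat_surj a) < real k / 2 ^ s"
proof -
  define n d where "n = (pr1 a + 1) div 2" and "d = (pr2 a + 1) div 2"
  have nd: "0 < pr1 a \<longleftrightarrow> 0 < n" "0 < pr2 a \<longleftrightarrow> 0 < d" by (auto simp: n_def d_def)
  have "real n / real d < real k / 2 ^ s \<longleftrightarrow> n * 2 ^ s < k * d" if "0 < d"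
  proof -
    have "real n / real d < real k / 2 ^ s \<longleftrightarrow> real (n * 2 ^ s) < real (k * d)"
      using that by (simp add: field_simps)
    then show ?thesis unfolding of_nat_less_iff .
  qed
  moreover have "- (real n / real d) < real k / 2 ^ s \<longleftrightarrow> 0 < k \<or> 0 < n \<and> 0 < d"
  proof (cases "0 < k")
    case True
    then have "0 < real k / 2 ^ s" by simp
    moreover have "0 \<le> real n / real d" by simp
    ultimately show ?thesis using True by linarith
  qed (auto simp: zero_less_divide_iff)
  ultimately show ?thesis
    unfolding rat_less_dyadic_def real_of_rat_nat_to_rat_surj n_def[symmetric] d_def[symmetric] nd
    using nd by (auto simp: zero_less_divide_iff)
qed

lemma dyadic_less_rat_iff:
  "dyadic_less_rat s k a \<longleftrightarrow> real k / 2 ^ s < real_of_rat (nat_to_rat_surj a)"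
proof -
  define n d where "n = (pr1 a + 1) div 2" and "d = (pr2 a + 1) div 2"
  have nd: "0 < pr2 a \<longleftrightarrow> 0 < d" by (auto simp: d_def)
  have "real k / 2 ^ s < real n / real d \<longleftrightarrow> k * d < n * 2 ^ s" if "0 < d"
  proof -
    have "real k / 2 ^ s < real n / real d \<longleftrightarrow> real (k * d) < real (n * 2 ^ s)"
      using that by (simp add: field_simps)
    then show ?thesis unfolding of_nat_less_iff .
  qed
  moreover have "\<not> real k / 2 ^ s < - (real n / real d)"
  proof -
    have "0 \<le> real k / 2 ^ s" "0 \<le> real n / real d" by simp_all
    then show ?thesis by linarith
  qed
  moreover have "\<not> real k / 2 ^ s < 0" by (simp add: not_less)
  ultimately show ?thesis
    unfolding dyadic_less_rat_def real_of_rat_nat_to_rat_surj n_def[symmetric] d_def[symmetric] nd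
    by (cases "0 < d") auto
qed

text \<open>The uncovered cells of level \<open>s\<close> make up the stage \<open>s\<close>
  approximation of the closed class. Asking for a single open interval around the closed cell
  reduces the test to two comparisons of rationals.\<close>

definition covered :: "(nat \<Rightarrow> nat) \<Rightarrow> nat \<Rightarrow> nat \<Rightarrow> bool" where
  "covered f s k \<longleftrightarrow> (\<exists>i<s. rat_less_dyadic (pr1 (f i)) s k \<and> dyadic_less_rat s (Suc k) (pr2 (f i)))"

lemma covered_iff:
  "covered f s k \<longleftrightarrow> (\<exists>i<s. {real k / 2 ^ s..real (Suc k) / 2 ^ s} \<subseteq> rat_interval (f i))"
proof -
  have "real k / 2 ^ s \<le> real (Suc k) / 2 ^ s" by (simp add: divide_right_mono)
  then have "{real k / 2 ^ s..real (Suc k) / 2 ^ s} \<subseteq> rat_interval m \<longleftrightarrow>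
      real_of_rat (nat_to_rat_surj (pr1 m)) < real k / 2 ^ s \<and>
      real (Suc k) / 2 ^ s < real_of_rat (nat_to_rat_surj (pr2 m))" for m
    by (auto simp: rat_interval_def split: prod.split)
  then show ?thesis
    unfolding covered_def rat_less_dyadic_iff dyadic_less_rat_iff by blast
qed

lemma closed_cell_Suc_subset:
  "{real k / 2 ^ Suc s..real (Suc k) / 2 ^ Suc s} \<subseteq>
   {real (k div 2) / 2 ^ s..real (Suc (k div 2)) / 2 ^ s}"
proof -
  have "2 * (k div 2) \<le> k" "Suc k \<le> 2 * Suc (k div 2)" by auto
  then have "real (2 * (k div 2)) \<le> real k" "real (Suc k) \<le> real (2 * Suc (k div 2))"
    unfolding of_nat_le_iff .
  then have "real (2 * (k div 2)) / 2 ^ Suc s \<le> real k / 2 ^ Suc s"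
    "real (Suc k) / 2 ^ Suc s \<le> real (2 * Suc (k div 2)) / 2 ^ Suc s"
    by - (rule divide_right_mono, assumption, simp)+
  moreover have "real (2 * m) / 2 ^ Suc s = real m / 2 ^ s" for m by simp
  ultimately show ?thesis by (auto simp only: atLeastatMost_subset_iff)
qed

lemma covered_Suc: "covered f s (k div 2) \<Longrightarrow> covered f (Suc s) k"
  unfolding covered_iff using closed_cell_Suc_subset[of k s] by (meson less_SucI order_trans)

lemma decidable_covered:
  assumes f: "computable_from A f" and "computable_from A g" "computable_from A h"
  shows "decidable_from A (\<lambda>u. covered f (g u) (h u))"
  unfolding covered_def rat_less_dyadic_def dyadic_less_rat_def
  by (intro computable_intros computable_comp[OF f] computable_comp[OF assms(2)]
      computable_comp[OF assms(3)] assms(2,3))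

text \<open>Among the cells from \<open>i\<close> to \<open>j\<close>, the density of the stage
  \<open>s\<close> approximation is below \<open>2 powr -n\<close>. The conjunction is grouped to
  match \<open>computable_card\<close>.\<close>

definition sparse :: "(nat \<Rightarrow> nat) \<Rightarrow> nat \<Rightarrow> nat \<Rightarrow> nat \<Rightarrow> nat \<Rightarrow> bool" where
  "sparse f n s i j \<longleftrightarrow> card {k. k < j \<and> (i \<le> k \<and> \<not> covered f s k)} * 2 ^ n < j - i"

definition near_sparse :: "(nat \<Rightarrow> nat) \<Rightarrow> nat \<Rightarrow> nat \<Rightarrow> nat \<Rightarrow> bool" where
  "near_sparse f n s k \<longleftrightarrow> (\<exists>i<Suc k. \<exists>j<Suc (2 ^ s). k < j \<and> sparse f n s i j)"

lemma decidable_near_sparse: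
  assumes f: "computable_from A f" and "computable_from A m" "computable_from A g" "computable_from A h"
  shows "decidable_from A (\<lambda>u. near_sparse f (m u) (g u) (h u))"
proof -
  have "decidable_from A (\<lambda>u. near_sparse f (pr1 u) (pr1 (pr2 u)) (pr2 (pr2 u)))"
    unfolding near_sparse_def sparse_def by (intro computable_intros decidable_covered[OF f])
  from decidable_comp3[OF this assms(2-4)] show ?thesis .
qed

text \<open>Every uncovered cell of the next level is half of an uncovered cell, so the count at
  most doubles while the number of cells doubles.\<close>

lemma sparse_Suc: "sparse f n s i j \<Longrightarrow> sparse f n (Suc s) (2 * i) (2 * j)"
proof -
  assume sp: "sparse f n s i j"
  let ?S = "{k. k < j \<and> (i \<le> k \<and> \<not> covered f s k)}"
  have "{k. k < 2 * j \<and> (2 * i \<le> k \<and> \<not> covered f (Suc s) k)} \<subseteq> {k. k div 2 \<in> ?S}"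
    using covered_Suc by auto
  also have "\<dots> \<subseteq> (\<lambda>k. 2 * k) ` ?S \<union> (\<lambda>k. Suc (2 * k)) ` ?S"
  proof
    fix k assume k: "k \<in> {k. k div 2 \<in> ?S}"
    have "k = 2 * (k div 2) \<or> k = Suc (2 * (k div 2))" by presburger
    then show "k \<in> (\<lambda>k. 2 * k) ` ?S \<union> (\<lambda>k. Suc (2 * k)) ` ?S" using k by blast
  qed
  finally have "card {k. k < 2 * j \<and> (2 * i \<le> k \<and> \<not> covered f (Suc s) k)}
      \<le> card ((\<lambda>k. 2 * k) ` ?S \<union> (\<lambda>k. Suc (2 * k)) ` ?S)"
    by (intro card_mono) auto
  also have "\<dots> \<le> card ((\<lambda>k. 2 * k) ` ?S) + card ((\<lambda>k. Suc (2 * k)) ` ?S)" by (rule card_Un_le)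
  also have "\<dots> \<le> card ?S + card ?S" by (intro add_mono card_image_le) auto
  finally have "card {k. k < 2 * j \<and> (2 * i \<le> k \<and> \<not> covered f (Suc s) k)} * 2 ^ n
      \<le> (card ?S + card ?S) * 2 ^ n" by (rule mult_right_mono) simp
  also have "\<dots> < 2 * j - 2 * i" using sp unfolding sparse_def add_mult_distrib by linarith
  finally show ?thesis unfolding sparse_def .
qed

lemma near_sparse_Suc: "near_sparse f n s (k div 2) \<Longrightarrow> near_sparse f n (Suc s) k"
proof -
  assume "near_sparse f n s (k div 2)"
  then obtain i j where ij: "i \<le> k div 2" "k div 2 < j" "j \<le> 2 ^ s" "sparse f n s i j"
    unfolding near_sparse_def by (auto simp: less_Suc_eq_le)
  then have "2 * i \<le> k" "k < 2 * j" "2 * j \<le> 2 ^ Suc s" by auto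
  then show ?thesis unfolding near_sparse_def less_Suc_eq_le using sparse_Suc[OF ij(4)] by blast
qed

lemma near_sparse_mono:
  "near_sparse f n s (cell_index z s) \<Longrightarrow> s \<le> t \<Longrightarrow> near_sparse f n t (cell_index z t)"
proof (induction t)
  case (Suc t)
  show ?case
  proof (cases "s = Suc t")
    case False
    then have "near_sparse f n t (cell_index z t)" using Suc by simp
    then show ?thesis using cell_index_div[of t "Suc t" z] by (intro near_sparse_Suc) simp
  qed (use Suc.prems in simp)
qed simp

section \<open>A discrete covering argument\<close>

lemma card_mult_le_of_cover:
  assumes "A \<subseteq> B \<union> C" "finite B" "finite C"
  shows "card A * c \<le> card B * c + card C * (c::nat)"
proof -
  have "card A \<le> card (B \<union> C)" using assms by (intro card_mono) auto
  also have "\<dots> \<le> card B + card C" by (rule card_Un_le)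
  finally have "card A * c \<le> (card B + card C) * c" by simp
  then show ?thesis by (simp only: add_mult_distrib)
qed

text \<open>A one-sided maximal inequality, by a greedy sweep from the left. If a sparse interval
  starts at \<open>x\<close>, its points of \<open>G\<close> are charged to its length and the sweep
  continues at its end; otherwise \<open>x\<close> is skipped. The intervals used are
  disjoint.\<close>

lemma card_right_sparse:
  fixes G :: "nat set"
  assumes "x \<le> N"
  shows "card {k \<in> G. x \<le> k \<and> k < N \<and> (\<exists>j\<le>N. k < j \<and> card (G \<inter> {k..<j}) * c \<le> 2 * (j - k))} * c
    \<le> 2 * (N - x)" (is "card (?V x) * c \<le> _")
  using assms
proof (induction "N - x" arbitrary: x rule: less_induct)
  case less
  show ?case
  proof (cases "x = N")
    case False
    then have "x < N" using less.prems by simp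
    show ?thesis
    proof (cases "\<exists>j\<le>N. x < j \<and> card (G \<inter> {x..<j}) * c \<le> 2 * (j - x)")
      case True
      then obtain j where j: "j \<le> N" "x < j" "card (G \<inter> {x..<j}) * c \<le> 2 * (j - x)" by blast
      have "?V x \<subseteq> (G \<inter> {x..<j}) \<union> ?V j" by auto
      then have "card (?V x) * c \<le> card (G \<inter> {x..<j}) * c + card (?V j) * c"
        by (rule card_mult_le_of_cover) simp_all
      also have "\<dots> \<le> 2 * (j - x) + 2 * (N - j)"
        using j less.hyps[of j] by (intro add_mono) auto
      finally show ?thesis using j by simp
    next
      case no: False
      have "?V x \<subseteq> ?V (Suc x)"
      proof
        fix k assume k: "k \<in> ?V x"
        then have "k \<noteq> x" using no by blast
        then show "k \<in> ?V (Suc x)" using k by auto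
      qed
      then have "card (?V x) * c \<le> card (?V (Suc x)) * c"
        by (intro mult_right_mono card_mono) auto
      also have "\<dots> \<le> 2 * (N - Suc x)" using less.hyps[of "Suc x"] \<open>x < N\<close> by simp
      finally show ?thesis by simp
    qed
  qed (simp add: not_less[symmetric])
qed

text \<open>The mirror image, sweeping from the right; the intervals end with the point
  \<open>k\<close> included.\<close>

lemma card_left_sparse:
  fixes G :: "nat set"
  shows "card {k \<in> G. k < x \<and> (\<exists>i\<le>k. card (G \<inter> {i..<Suc k}) * c \<le> 2 * (Suc k - i))} * c
    \<le> 2 * x" (is "card (?V x) * c \<le> _")
proof (induction x rule: less_induct)
  case (less x)
  show ?case
  proof (cases x)
    case (Suc k)
    show ?thesis
    proof (cases "\<exists>i\<le>k. card (G \<inter> {i..<Suc k}) * c \<le> 2 * (Suc k - i)")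
      case True
      then obtain i where i: "i \<le> k" "card (G \<inter> {i..<Suc k}) * c \<le> 2 * (Suc k - i)" by blast
      have "?V x \<subseteq> (G \<inter> {i..<Suc k}) \<union> ?V i" using Suc by auto
      then have "card (?V x) * c \<le> card (G \<inter> {i..<Suc k}) * c + card (?V i) * c"
        by (rule card_mult_le_of_cover) simp_all
      also have "\<dots> \<le> 2 * (Suc k - i) + 2 * i"
        using i less.IH[of i] Suc by (intro add_mono) auto
      finally show ?thesis using i Suc by simp
    next
      case False
      then have "?V x \<subseteq> ?V k" using Suc less_Suc_eq by auto
      then have "card (?V x) * c \<le> card (?V k) * c"
        by (intro mult_right_mono card_mono) auto
      also have "\<dots> \<le> 2 * k" using less.IH[of k] Suc by simp
      finally show ?thesis using Suc by simp
    qed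
  qed simp
qed

text \<open>One of the two parts into which a point of \<open>G\<close> splits a sparse interval is again sparse,
  up to a factor 2 since the point is counted twice.\<close>

lemma card_near_sparse:
  "card {k. k < 2 ^ s \<and> near_sparse f n s k \<and> \<not> covered f s k} * 2 ^ n \<le> 4 * 2 ^ s"
proof -
  define G where "G = {k. \<not> covered f s k}"
  define N where "N = (2 ^ s :: nat)"
  let ?R = "{k \<in> G. 0 \<le> k \<and> k < N \<and> (\<exists>j\<le>N. k < j \<and> card (G \<inter> {k..<j}) * 2 ^ n \<le> 2 * (j - k))}"
  let ?L = "{k \<in> G. k < N \<and> (\<exists>i\<le>k. card (G \<inter> {i..<Suc k}) * 2 ^ n \<le> 2 * (Suc k - i))}"
  have "{k. k < 2 ^ s \<and> near_sparse f n s k \<and> \<not> covered f s k} \<subseteq> ?R \<union> ?L"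
  proof clarify
    fix k assume k: "k < 2 ^ s" "near_sparse f n s k" "\<not> covered f s k"
      and L: "\<not> (k \<in> G \<and> k < N \<and> (\<exists>i\<le>k. card (G \<inter> {i..<Suc k}) * 2 ^ n \<le> 2 * (Suc k - i)))"
    have "k \<in> G" "k < N" using k by (auto simp: G_def N_def)
    obtain i j where ij: "i \<le> k" "k < j" "j \<le> N" "sparse f n s i j"
      using k(2) unfolding near_sparse_def N_def by (auto simp: less_Suc_eq_le)
    have "{k. k < j \<and> (i \<le> k \<and> \<not> covered f s k)} = G \<inter> {i..<j}" by (auto simp: G_def)
    then have g: "card (G \<inter> {i..<j}) * 2 ^ n < j - i" using ij(4) by (simp add: sparse_def)
    have "card (G \<inter> {i..<Suc k}) + card (G \<inter> {k..<j}) =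
        card ((G \<inter> {i..<Suc k}) \<union> (G \<inter> {k..<j})) + card ((G \<inter> {i..<Suc k}) \<inter> (G \<inter> {k..<j}))"
      by (rule card_Un_Int) auto
    also have "(G \<inter> {i..<Suc k}) \<union> (G \<inter> {k..<j}) = G \<inter> {i..<j}" using ij by auto
    also have "(G \<inter> {i..<Suc k}) \<inter> (G \<inter> {k..<j}) = {k}" using ij \<open>k \<in> G\<close> by auto
    finally have ab: "card (G \<inter> {i..<Suc k}) + card (G \<inter> {k..<j}) = card (G \<inter> {i..<j}) + 1" by simp
    have "k \<in> G \<inter> {i..<j}" using ij \<open>k \<in> G\<close> by auto
    then have "1 \<le> card (G \<inter> {i..<j})" by (metis One_nat_def Suc_leI card_gt_0_iff empty_iff finite_Int finite_atLeastLessThan)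
    then have "(card (G \<inter> {i..<Suc k}) + card (G \<inter> {k..<j})) * 2 ^ n \<le> 2 * card (G \<inter> {i..<j}) * 2 ^ n"
      unfolding ab by (intro mult_right_mono) auto
    also have "\<dots> < 2 * (j - i)" using g by simp
    finally have "card (G \<inter> {i..<Suc k}) * 2 ^ n + card (G \<inter> {k..<j}) * 2 ^ n < 2 * (j - i)"
      by (simp add: add_mult_distrib)
    moreover have "2 * (Suc k - i) < card (G \<inter> {i..<Suc k}) * 2 ^ n"
      using L \<open>k \<in> G\<close> \<open>k < N\<close> ij(1) by (metis not_le)
    ultimately have "card (G \<inter> {k..<j}) * 2 ^ n \<le> 2 * (j - k)" using ij by linarith
    then show "k \<in> G \<and> 0 \<le> k \<and> k < N \<and> (\<exists>j\<le>N. k < j \<and> card (G \<inter> {k..<j}) * 2 ^ n \<le> 2 * (j - k))"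
      using ij \<open>k \<in> G\<close> \<open>k < N\<close> by auto
  qed
  then have "card {k. k < 2 ^ s \<and> near_sparse f n s k \<and> \<not> covered f s k} * 2 ^ n
      \<le> card ?R * 2 ^ n + card ?L * 2 ^ n"
    by (rule card_mult_le_of_cover) simp_all
  also have "\<dots> \<le> 2 * (N - 0) + 2 * N"
    by (intro add_mono card_right_sparse card_left_sparse) simp
  finally show ?thesis by (simp add: N_def)
qed

text \<open>The half-open cells inside the closed ones are disjoint, so their measures add
  up.\<close>

lemma card_le_measure_closed_cells:
  assumes "finite J"
  shows "card J / 2 ^ s \<le> measure lborel (\<Union>k\<in>J. {real k / 2 ^ s..real (Suc k) / 2 ^ s})"
proof -
  let ?H = "\<lambda>k. {real k / 2 ^ s..<real (Suc k) / 2 ^ s}"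
  let ?I = "\<lambda>k. {real k / 2 ^ s..real (Suc k) / 2 ^ s}"
  have le: "real k / 2 ^ s \<le> real (Suc k) / 2 ^ s" for k by (simp add: divide_right_mono)
  have disj: "disjoint_family_on ?H J"
    unfolding disjoint_family_on_def
  proof (intro ballI impI, rule ccontr)
    fix a b assume "a \<noteq> b" "?H a \<inter> ?H b \<noteq> {}"
    then obtain x where x: "x \<in> ?H a" "x \<in> ?H b" by blast
    have "0 \<le> real a / 2 ^ s" by simp
    then have "0 \<le> x" using x(1) unfolding atLeastLessThan_iff by linarith
    then show False using x \<open>a \<noteq> b\<close> mem_half_open_cell_iff by metis
  qed
  have H: "measure lborel (?H k) = 1 / 2 ^ s" for k
    using le[of k] by (simp add: add_divide_distrib)
  have "card J / 2 ^ s = (\<Sum>k\<in>J. measure lborel (?H k))" by (simp only: H sum_constant) simp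
  also have "\<dots> = measure lborel (\<Union>k\<in>J. ?H k)"
    using le by (intro measure_finite_Union[OF assms _ disj, symmetric])
      (auto simp: emeasure_lborel_Ico)
  also have "\<dots> \<le> measure lborel (\<Union>k\<in>J. ?I k)"
  proof (rule measure_mono_fmeasurable)
    show "(\<Union>k\<in>J. ?H k) \<subseteq> (\<Union>k\<in>J. ?I k)" by (intro UN_mono) auto
    show "(\<Union>k\<in>J. ?H k) \<in> sets lborel" using assms by (intro sets.finite_UN) auto
    show "(\<Union>k\<in>J. ?I k) \<in> fmeasurable lborel"
      using assms by (intro fmeasurable.finite_UN) (auto simp: fmeasurable_def emeasure_lborel_Icc_eq)
  qed
  finally show ?thesis .
qed

section \<open>Points of density zero\<close>

text \<open>The uncovered closed cells between the endpoints form a decreasing sequence of sets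
  whose intersection lies in \<open>C\<close>. By continuity of measure from above, some stage is
  already small.\<close>

lemma eventually_sparse:
  assumes C: "{0..1} - C = {0..1} \<inter> (\<Union>i. rat_interval (f i))" "C \<in> sets borel"
    and j: "j \<le> 2 ^ s" "i < j"
    and small: "measure lborel ({real i / 2 ^ s..real j / 2 ^ s} \<inter> C) < real (j - i) / 2 ^ n / 2 ^ s"
  shows "\<exists>r. sparse f n (s + r) (i * 2 ^ r) (j * 2 ^ r)"
proof -
  define J where "J r = {k. k < j * 2 ^ r \<and> (i * 2 ^ r \<le> k \<and> \<not> covered f (s + r) k)}" for r
  let ?I = "\<lambda>t k. {real k / 2 ^ t..real (Suc k) / 2 ^ t}"
  define M where "M r = (\<Union>k\<in>J r. ?I (s + r) k)" for r
  have fin: "finite (J r)" for r by (simp add: J_def)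
  have M_borel: "M r \<in> sets borel" for r unfolding M_def using fin by (intro sets.finite_UN) auto
  have M_Suc: "M (Suc r) \<subseteq> M r" for r
  proof
    fix x assume "x \<in> M (Suc r)"
    then obtain k where k: "k \<in> J (Suc r)" "x \<in> ?I (s + Suc r) k" unfolding M_def by blast
    then have "k div 2 \<in> J r" using covered_Suc[of f "s + r" k] by (auto simp: J_def)
    moreover have "x \<in> ?I (s + r) (k div 2)" using k(2) closed_cell_Suc_subset[of k "s + r"] by auto
    ultimately show "x \<in> M r" unfolding M_def by blast
  qed
  have range: "?I (s + r) k \<subseteq> {real i / 2 ^ s..real j / 2 ^ s}" if "k \<in> J r" for r k
  proof -
    have "i * 2 ^ r \<le> k" "Suc k \<le> j * 2 ^ r" using that by (auto simp: J_def)
    then have "real (i * 2 ^ r) \<le> real k" "real (Suc k) \<le> real (j * 2 ^ r)" unfolding of_nat_le_iff .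
    then have "real (i * 2 ^ r) / 2 ^ (s + r) \<le> real k / 2 ^ (s + r)"
      "real (Suc k) / 2 ^ (s + r) \<le> real (j * 2 ^ r) / 2 ^ (s + r)"
      by - (rule divide_right_mono, assumption, simp)+
    moreover have "real (m * 2 ^ r) / 2 ^ (s + r) = real m / 2 ^ s" for m by (simp add: power_add)
    ultimately show ?thesis by (auto simp only: atLeastatMost_subset_iff)
  qed
  have ij01: "{real i / 2 ^ s..real j / 2 ^ s} \<subseteq> {0..1}"
  proof -
    have "real j \<le> real (2 ^ s)" unfolding of_nat_le_iff by (rule j)
    then show ?thesis by auto
  qed
  have "(\<Inter>r. M r) \<subseteq> {real i / 2 ^ s..real j / 2 ^ s} \<inter> C"
  proof
    fix x assume x: "x \<in> (\<Inter>r. M r)"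
    then have xij: "x \<in> {real i / 2 ^ s..real j / 2 ^ s}" using range[of _ 0] unfolding M_def by blast
    moreover have "x \<in> C"
    proof (rule ccontr)
      assume "x \<notin> C"
      then have "x \<in> {0..1} \<inter> (\<Union>i. rat_interval (f i))" using xij ij01 C(1) by blast
      then obtain p where p: "x \<in> rat_interval (f p)" by blast
      obtain a b where ab: "rat_interval (f p) = {a<..<b}"
        using that[of "real_of_rat (nat_to_rat_surj (pr1 (f p)))" "real_of_rat (nat_to_rat_surj (pr2 (f p)))"]
        by (simp add: rat_interval_def case_prod_beta)
      have "0 < min (x - a) (b - x)" using p ab by auto
      then obtain q where q: "(1 / 2) ^ q < min (x - a) (b - x)"
        using real_arch_pow_inv[of "min (x - a) (b - x)" "1/2"] by auto
      \<comment> \<open>Level \<open>s + r\<close> is fine enough for a cell containing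
        \<open>x\<close> to fit into the interval, and late enough for the interval with index
        \<open>p\<close> to count.\<close>
      define r where "r = max q (Suc p)"
      obtain k where k: "k \<in> J r" "x \<in> ?I (s + r) k" using x unfolding M_def by blast
      have "1 / 2 ^ (s + r) \<le> (1 / 2 :: real) ^ q"
        by (simp add: r_def power_one_over frac_le power_increasing)
      moreover have "real (Suc k) / 2 ^ (s + r) = real k / 2 ^ (s + r) + 1 / 2 ^ (s + r)"
        by (simp add: add_divide_distrib)
      ultimately have "?I (s + r) k \<subseteq> {a<..<b}" using k(2) q by auto
      moreover have "p < s + r" by (simp add: r_def)
      ultimately have "covered f (s + r) k" unfolding covered_iff ab[symmetric] by blast
      then show False using k(1) by (simp add: J_def)
    qed
    ultimately show "x \<in> {real i / 2 ^ s..real j / 2 ^ s} \<inter> C" by blast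
  qed
  then have "measure lborel (\<Inter>r. M r) \<le> measure lborel ({real i / 2 ^ s..real j / 2 ^ s} \<inter> C)"
  proof (rule measure_mono_fmeasurable)
    show "(\<Inter>r. M r) \<in> sets lborel" using M_borel by auto
    have "{real i / 2 ^ s..real j / 2 ^ s} \<in> fmeasurable lborel"
      by (simp add: fmeasurable_def emeasure_lborel_Icc_eq)
    then show "{real i / 2 ^ s..real j / 2 ^ s} \<inter> C \<in> fmeasurable lborel"
      using C(2) by (simp add: fmeasurable_Int_fmeasurable)
  qed
  then have lt: "measure lborel (\<Inter>r. M r) < real (j - i) / 2 ^ n / 2 ^ s" using small by linarith
  have "(\<lambda>r. measure lborel (M r)) \<longlonglongrightarrow> measure lborel (\<Inter>r. M r)"
  proof (rule Lim_measure_decseq)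
    show "range M \<subseteq> sets lborel" using M_borel by auto
    show "decseq M" by (rule decseq_SucI) (rule M_Suc)
    show "emeasure lborel (M r) \<noteq> \<infinity>" for r
    proof -
      have "emeasure lborel (M r) \<le> emeasure lborel {real i / 2 ^ s..real j / 2 ^ s}"
        using range unfolding M_def by (intro emeasure_mono) (blast, simp)
      then show ?thesis by (auto simp: emeasure_lborel_Icc_eq top_unique)
    qed
  qed
  from order_tendstoD(2)[OF this lt] obtain r where
    "measure lborel (M r) < real (j - i) / 2 ^ n / 2 ^ s"
    by (auto simp: eventually_sequentially)
  then have "card (J r) / 2 ^ (s + r) < real (j - i) / 2 ^ n / 2 ^ s"
    using card_le_measure_closed_cells[OF fin, of r "s + r"] unfolding M_def by linarith
  then have "real (card (J r) * 2 ^ n) < real ((j - i) * 2 ^ r)"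
    by (simp add: field_simps power_add)
  then have "card (J r) * 2 ^ n < (j - i) * 2 ^ r" unfolding of_nat_less_iff .
  then show ?thesis unfolding sparse_def J_def[symmetric] by (auto simp: diff_mult_distrib)
qed

lemma zero_density_near_sparse:
  assumes ml: "martin_loef_random z" "z \<in> {0..1}"
    and C: "{0..1} - C = {0..1} \<inter> (\<Union>i. rat_interval (f i))" "C \<in> sets borel"
    and dens: "\<not> lower_density C z > 0"
  shows "\<exists>t. near_sparse f n t (cell_index z t)"
proof -
  \<comment> \<open>The additional factor 1/2 pays for the passage to dyadic endpoints, which keeps
    at least half of the length.\<close>
  define e where "e = 1 / 2 ^ n / (2::real)"
  have e: "0 < e" by (simp add: e_def)
  have z: "0 < z" "z < 1" using martin_loef_random_bounds[OF ml] by auto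
  \<comment> \<open>Radii below \<open>h\<close> keep the interval inside the unit interval.\<close>
  define h where "h = min z (1 - z)"
  have h: "0 < h" using z by (simp add: h_def)
  let ?F = "\<lambda>(\<gamma>, \<delta>). ereal (measure lborel ({z - \<gamma>..z + \<delta>} \<inter> C) / (\<gamma> + \<delta>))"
  have "\<not> (\<forall>\<^sub>F x in at_right 0 \<times>\<^sub>F at_right 0. ereal e \<le> ?F x)"
  proof
    assume "\<forall>\<^sub>F x in at_right 0 \<times>\<^sub>F at_right 0. ereal e \<le> ?F x"
    then have "ereal e \<le> lower_density C z" unfolding lower_density_def by (rule Liminf_bounded)
    moreover have "0 < ereal e" using e by simp
    ultimately show False using dens by (metis less_le_trans)
  qed
  moreover have "eventually (\<lambda>y. 0 < y \<and> y < h) (at_right (0::real))"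
    unfolding eventually_at_right_field using h by (intro exI[of _ h]) auto
  ultimately have "\<not> (\<forall>\<gamma> \<delta>. 0 < \<gamma> \<and> \<gamma> < h \<longrightarrow> 0 < \<delta> \<and> \<delta> < h \<longrightarrow> ereal e \<le> ?F (\<gamma>, \<delta>))"
    unfolding eventually_prod_filter by blast
  then obtain \<gamma> \<delta> where \<gamma>\<delta>: "0 < \<gamma>" "\<gamma> < h" "0 < \<delta>" "\<delta> < h"
    and "measure lborel ({z - \<gamma>..z + \<delta>} \<inter> C) / (\<gamma> + \<delta>) < e" by (auto simp: not_le)
  then have small: "measure lborel ({z - \<gamma>..z + \<delta>} \<inter> C) < e * (\<gamma> + \<delta>)"
    by (simp add: divide_less_eq)
  have "0 < min \<gamma> \<delta> / 2" using \<gamma>\<delta> by simp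
  then obtain s where "(1 / 2) ^ s < min \<gamma> \<delta> / 2"
    using real_arch_pow_inv[of "min \<gamma> \<delta> / 2" "1/2"] by auto
  then have s: "1 / 2 ^ s < \<gamma> / 2" "1 / 2 ^ s < \<delta> / 2" by (auto simp: power_one_over)
  \<comment> \<open>The left endpoint is rounded up and the right one down, so the dyadic interval
    lies inside the given one; by the choice of \<open>s\<close> it still contains the cell of
    \<open>z\<close>.\<close>
  define i j where "i = Suc (cell_index (z - \<gamma>) s)" and "j = cell_index (z + \<delta>) s"
  have nonneg: "0 \<le> z - \<gamma>" "0 \<le> z + \<delta>" "z + \<delta> < 1" using \<gamma>\<delta> by (auto simp: h_def)
  have Suc_div: "real (Suc m) / 2 ^ s = real m / 2 ^ s + 1 / 2 ^ s" for m
    by (simp add: add_divide_distrib)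
  have i: "z - \<gamma> < real i / 2 ^ s" "real i / 2 ^ s \<le> z - \<gamma> + 1 / 2 ^ s"
    using cell_index_bounds[OF nonneg(1), of s] unfolding i_def Suc_div by auto
  have j: "real j / 2 ^ s \<le> z + \<delta>" "z + \<delta> - 1 / 2 ^ s < real j / 2 ^ s"
    using cell_index_bounds[OF nonneg(2), of s] unfolding j_def Suc_div by auto
  have half: "\<gamma> + \<delta> \<le> 2 * (b - a)"
    if "z - \<gamma> < a" "a \<le> z - \<gamma> + u" "b \<le> z + \<delta>" "z + \<delta> - u < b" "u < \<gamma> / 2" "u < \<delta> / 2" for a b u
    using that by (simp add: field_simps)
  have mono: "a < b" if "real a / 2 ^ s < real b / 2 ^ s" for a b
  proof -
    have "real a < real b" using that by (simp add: divide_less_cancel)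
    then show ?thesis by simp
  qed
  have k: "i \<le> cell_index z s" "cell_index z s < j"
  proof -
    have b: "real (cell_index z s) / 2 ^ s \<le> z" "z < real (Suc (cell_index z s)) / 2 ^ s"
      using cell_index_bounds[of z s] z by auto
    have "i < Suc (cell_index z s)" using b i s \<gamma>\<delta> by (intro mono) linarith
    then show "i \<le> cell_index z s" by simp
    show "cell_index z s < j" using b j s \<gamma>\<delta> by (intro mono) linarith
  qed
  have "j < 2 ^ s" unfolding j_def using nonneg by (intro cell_index_less) auto
  have "measure lborel ({real i / 2 ^ s..real j / 2 ^ s} \<inter> C) \<le> measure lborel ({z - \<gamma>..z + \<delta>} \<inter> C)"
  proof (rule measure_mono_fmeasurable)
    show "{real i / 2 ^ s..real j / 2 ^ s} \<inter> C \<subseteq> {z - \<gamma>..z + \<delta>} \<inter> C" using i j by auto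
    show "{real i / 2 ^ s..real j / 2 ^ s} \<inter> C \<in> sets lborel" using C(2) by auto
    have "{z - \<gamma>..z + \<delta>} \<in> fmeasurable lborel" by (simp add: fmeasurable_def emeasure_lborel_Icc_eq)
    then show "{z - \<gamma>..z + \<delta>} \<inter> C \<in> fmeasurable lborel"
      using C(2) by (simp add: fmeasurable_Int_fmeasurable)
  qed
  also have "\<dots> < e * (\<gamma> + \<delta>)" by (rule small)
  also have "\<dots> \<le> e * (2 * (real j / 2 ^ s - real i / 2 ^ s))"
    using e half[OF i j s] by (intro mult_left_mono) simp_all
  also have "\<dots> = real (j - i) / 2 ^ n / 2 ^ s"
  proof -
    have "real (j - i) = real j - real i" using k by simp
    then show ?thesis unfolding e_def by (simp add: diff_divide_distrib mult.commute)
  qed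
  finally obtain r where r: "sparse f n (s + r) (i * 2 ^ r) (j * 2 ^ r)"
    using eventually_sparse[OF C, of j s i n] k \<open>j < 2 ^ s\<close> by auto
  have "cell_index z (s + r) div 2 ^ r = cell_index z s"
    using cell_index_div[of s "s + r" z] by simp
  then have "cell_index z s * 2 ^ r \<le> cell_index z (s + r)"
    "cell_index z (s + r) < Suc (cell_index z s) * 2 ^ r"
    using div_power_eq_iff[of "cell_index z (s + r)" r "cell_index z s"] by auto
  moreover have "i * 2 ^ r \<le> cell_index z s * 2 ^ r" "Suc (cell_index z s) * 2 ^ r \<le> j * 2 ^ r"
    "j * 2 ^ r \<le> 2 ^ s * 2 ^ r"
    using k \<open>j < 2 ^ s\<close> by (intro mult_right_mono; simp)+
  ultimately have "i * 2 ^ r \<le> cell_index z (s + r)" "cell_index z (s + r) < j * 2 ^ r"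
    "j * 2 ^ r \<le> 2 ^ (s + r)" unfolding power_add by linarith+
  then show ?thesis unfolding near_sparse_def less_Suc_eq_le using r by blast
qed

section \<open>Computing the halting problem from a point of density zero\<close>

text \<open>The string has a prefix in the part of the approximation that is near a sparse interval
  when \<open>n\<close> enters the halting set. Fixing \<open>s\<close> as the first halting stage
  leaves a single level for each \<open>n\<close>, so the bound of \<open>card_near_sparse\<close>
  is paid once.\<close>

definition late :: "(nat \<Rightarrow> nat) \<Rightarrow> nat \<Rightarrow> nat \<Rightarrow> nat \<Rightarrow> bool" where
  "late f n t j \<longleftrightarrow> (\<exists>s<Suc t. halts n s \<and> (\<forall>s'<s. \<not> halts n s') \<and>
     near_sparse f n s (j div 2 ^ (t - s)) \<and> \<not> covered f s (j div 2 ^ (t - s)))"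

lemma late_Suc: "late f n t (j div 2) \<Longrightarrow> late f n (Suc t) j"
proof -
  assume "late f n t (j div 2)"
  then obtain s where s: "s \<le> t" "halts n s" "\<forall>s'<s. \<not> halts n s'"
    "near_sparse f n s (j div 2 div 2 ^ (t - s))" "\<not> covered f s (j div 2 div 2 ^ (t - s))"
    unfolding late_def less_Suc_eq_le by blast
  moreover have "j div 2 div 2 ^ (t - s) = j div 2 ^ (Suc t - s)"
    using s(1) by (simp add: Suc_diff_le div_mult2_eq)
  ultimately show ?thesis unfolding late_def by (intro exI[of _ s]) simp
qed

lemma decidable_late:
  assumes f: "computable_from A f" and "computable_from A n" "computable_from A t" "computable_from A j"
  shows "decidable_from A (\<lambda>u. late f (n u) (t u) (j u))"
proof -
  have "decidable_from A (\<lambda>u. late f (pr1 u) (pr1 (pr2 u)) (pr2 (pr2 u)))"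
    unfolding late_def
    by (intro computable_intros decidable_halts decidable_near_sparse[OF f] decidable_covered[OF f])
  from decidable_comp3[OF this assms(2-4)] show ?thesis .
qed

lemma card_late: "card {j. j < 2 ^ t \<and> late f n t j} * 2 ^ n \<le> 4 * 2 ^ t"
proof (cases "\<exists>s\<le>t. halts n s \<and> (\<forall>s'<s. \<not> halts n s')")
  case True
  then obtain s where s: "s \<le> t" "halts n s" "\<forall>s'<s. \<not> halts n s'" by blast
  let ?Q = "\<lambda>k. near_sparse f n s k \<and> \<not> covered f s k"
  have "s' = s" if "halts n s'" "\<forall>s''<s'. \<not> halts n s''" for s'
    using that s by (metis nat_neq_iff)
  then have "{j. j < 2 ^ t \<and> late f n t j} \<subseteq> {j. j < 2 ^ t \<and> ?Q (j div 2 ^ (t - s))}"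
    unfolding late_def by blast
  then have "card {j. j < 2 ^ t \<and> late f n t j} \<le> card {j. j < 2 ^ t \<and> ?Q (j div 2 ^ (t - s))}"
    by (intro card_mono) auto
  also have "\<dots> = card {k. k < 2 ^ s \<and> ?Q k} * 2 ^ (t - s)" by (rule card_refine[OF s(1)])
  finally have "card {j. j < 2 ^ t \<and> late f n t j} * 2 ^ n
      \<le> card {k. k < 2 ^ s \<and> ?Q k} * 2 ^ n * 2 ^ (t - s)" by simp
  also have "\<dots> \<le> 4 * 2 ^ s * 2 ^ (t - s)" by (intro mult_right_mono card_near_sparse) simp
  also have "\<dots> = 4 * 2 ^ t" using s(1) by (simp flip: power_add)
  finally show ?thesis .
next
  case False
  then have "{j. j < 2 ^ t \<and> late f n t j} = {}" unfolding late_def less_Suc_eq_le by blast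
  then show ?thesis by (simp only: card.empty)
qed

text \<open>The bounds \<open>4 * 2 powr -n\<close> for \<open>n\<close> from \<open>m + 3\<close>
  on sum to at most \<open>8 * 2 powr -(m + 3)\<close>, which is \<open>2 powr -m\<close>. The
  condition \<open>n < t\<close> keeps the family decidable.\<close>

lemma card_late_union:
  "card {j. j < 2 ^ t \<and> (\<exists>n<t. m + 3 \<le> n \<and> late f n t j)} * 2 ^ m \<le> 2 ^ t"
proof -
  have geo: "(\<Sum>n\<in>{a..<t}. 1 / 2 ^ n) \<le> 2 / (2::real) ^ a" for a
  proof (cases "a \<le> t")
    case True
    then have "(\<Sum>n\<in>{a..<t}. 1 / 2 ^ n) = 2 / (2::real) ^ a - 2 / 2 ^ t"
    proof (induction t rule: dec_induct)
      case (step t)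
      have "2 / 2 ^ Suc t = (2 / 2 ^ t - 1 / 2 ^ t :: real)" by simp
      then show ?case using step by (simp add: sum.atLeastLessThan_Suc del: power_Suc)
    qed simp
    then show ?thesis by simp
  qed simp
  have "card {j. j < 2 ^ t \<and> (\<exists>n<t. m + 3 \<le> n \<and> late f n t j)}
      \<le> card (\<Union>n\<in>{m + 3..<t}. {j. j < 2 ^ t \<and> late f n t j})"
    by (intro card_mono) auto
  also have "\<dots> \<le> (\<Sum>n\<in>{m + 3..<t}. card {j. j < 2 ^ t \<and> late f n t j})"
    by (rule card_UN_le) simp
  finally have "real (card {j. j < 2 ^ t \<and> (\<exists>n<t. m + 3 \<le> n \<and> late f n t j)})
      \<le> (\<Sum>n\<in>{m + 3..<t}. real (card {j. j < 2 ^ t \<and> late f n t j}))"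
    by (simp only: of_nat_le_iff flip: of_nat_sum)
  also have "\<dots> \<le> (\<Sum>n\<in>{m + 3..<t}. 4 * 2 ^ t * (1 / 2 ^ n))"
  proof (rule sum_mono)
    fix n
    have "real (card {j. j < 2 ^ t \<and> late f n t j} * 2 ^ n) \<le> real (4 * 2 ^ t)"
      unfolding of_nat_le_iff by (rule card_late)
    then show "real (card {j. j < 2 ^ t \<and> late f n t j}) \<le> 4 * 2 ^ t * (1 / 2 ^ n)"
      by (simp add: field_simps)
  qed
  also have "\<dots> = 4 * 2 ^ t * (\<Sum>n\<in>{m + 3..<t}. 1 / 2 ^ n)" by (rule sum_distrib_left[symmetric])
  also have "\<dots> \<le> 4 * 2 ^ t * (2 / 2 ^ (m + 3))" by (intro mult_left_mono geo) simp
  also have "\<dots> = 2 ^ t / 2 ^ m" by (simp add: power_add)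
  finally have "real (card {j. j < 2 ^ t \<and> (\<exists>n<t. m + 3 \<le> n \<and> late f n t j)} * 2 ^ m) \<le> real (2 ^ t)"
    by (simp add: field_simps)
  then show ?thesis unfolding of_nat_le_iff .
qed

lemma computable_cell_index:
  assumes "0 \<le> z" "z < 1" and "computable_from (binary_expansion z) g"
  shows "computable_from (binary_expansion z) (\<lambda>u. cell_index z (g u))"
proof -
  have "rec_nat 0 (\<lambda>n y. 2 * y + of_bool (n \<in> binary_expansion z)) t = cell_index z t" for t
  proof (induction t)
    case 0
    show ?case using cell_index_less[OF assms(1,2), of 0] by simp
  qed (simp add: cell_index_Suc[OF assms(1)])
  moreover have "computable_from (binary_expansion z)
      (\<lambda>u. rec_nat 0 (\<lambda>n y. 2 * y + of_bool (n \<in> binary_expansion z)) (g u))"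
    by (intro computable_intros decidable_oracle assms(3))
  ultimately show ?thesis by simp
qed

lemma not_positive_density_imp_computes_jump:
  assumes ml: "martin_loef_random z" "z \<in> {0..1}" and dens: "\<not> positive_density_point z"
  shows "turing_computes (binary_expansion z) (turing_jump {})"
proof -
  let ?Z = "binary_expansion z" and ?H = "turing_jump {}"
  have z: "0 \<le> z" "z < 1" using martin_loef_random_bounds[OF ml] by auto
  obtain C where C: "effectively_closed C" "z \<in> C" "\<not> lower_density C z > 0"
    using dens unfolding positive_density_point_def by blast
  obtain f where f: "computable f" "{0..1} - C = {0..1} \<inter> (\<Union>i. rat_interval (f i))"
    using C(1) unfolding effectively_closed_def effectively_open_def by blast
  note cf = computable_imp_computable_from[OF f(1)]
  have uncovered: "\<not> covered f s (cell_index z s)" for s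
  proof
    assume "covered f s (cell_index z s)"
    then obtain i where "{real (cell_index z s) / 2 ^ s..real (Suc (cell_index z s)) / 2 ^ s} \<subseteq> rat_interval (f i)"
      unfolding covered_iff by blast
    moreover have "z \<in> {real (cell_index z s) / 2 ^ s..real (Suc (cell_index z s)) / 2 ^ s}"
      using cell_index_bounds[OF z(1), of s] by auto
    ultimately show False using C(2) f(2) ml(2) by blast
  qed
  define R where "R m t j \<longleftrightarrow> (\<exists>n<t. m + 3 \<le> n \<and> late f n t j)" for m t j
  have "decidable_from {} (\<lambda>u. R (pr1 u) (pr1 (pr2 u)) (pr2 (pr2 u)))"
    unfolding R_def by (intro computable_intros decidable_late cf)
  moreover have "R m (Suc t) j" if "R m t (j div 2)" for m t j
    using that late_Suc unfolding R_def by (meson less_SucI)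
  moreover have "card {j. j < 2 ^ t \<and> R m t j} * 2 ^ m \<le> 2 ^ t" for m t
    unfolding R_def by (rule card_late_union)
  ultimately obtain m where m: "\<And>t. \<not> R m t (cell_index z t)"
    using martin_loef_random_escapes[OF ml] by blast
  \<comment> \<open>This stage is found by unbounded search with oracle \<open>z\<close>; the search
    ends because the density is zero.\<close>
  define \<tau> where "\<tau> n = (LEAST t. near_sparse f n t (cell_index z t))" for n
  have ex: "\<exists>t. near_sparse f n t (cell_index z t)" for n
    by (rule zero_density_near_sparse[OF ml f(2) effectively_closed_borel[OF C(1)] C(3)])
  have \<tau>: "near_sparse f n (\<tau> n) (cell_index z (\<tau> n))" for n
    unfolding \<tau>_def by (rule LeastI_ex[OF ex])
  have settled: "n \<in> ?H \<longleftrightarrow> halts n (\<tau> n)" if n: "m + 3 \<le> n" for n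
  proof
    assume "n \<in> ?H"
    then have halt: "\<exists>s. halts n s" by (simp add: mem_turing_jump_iff_halts)
    define s where "s = (LEAST s. halts n s)"
    have s: "halts n s" "\<forall>s'<s. \<not> halts n s'"
      unfolding s_def using LeastI_ex[OF halt] not_less_Least by blast+
    have "s < \<tau> n"
    proof (rule ccontr)
      \<comment> \<open>Near-sparseness persists from stage \<open>\<tau> n\<close> to the halting
        stage \<open>s\<close>, and \<open>z\<close> is never covered, so \<open>z\<close> would be
        caught by the test.\<close>
      assume "\<not> s < \<tau> n"
      then have ns: "near_sparse f n s (cell_index z s)" by (intro near_sparse_mono[OF \<tau>]) simp
      \<comment> \<open>The level must reach the stage \<open>s\<close> for \<open>late\<close> and
        exceed \<open>n\<close> for \<open>R\<close>.\<close>
      define t where "t = max s (Suc n)"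
      have "cell_index z t div 2 ^ (t - s) = cell_index z s"
        by (intro cell_index_div) (simp add: t_def)
      then have "late f n t (cell_index z t)"
        unfolding late_def using s ns uncovered[of s] by (intro exI[of _ s]) (auto simp: t_def)
      then have "R m t (cell_index z t)" unfolding R_def using n
        by (intro exI[of _ n]) (auto simp: t_def)
      then show False using m by blast
    qed
    then show "halts n (\<tau> n)" using halts_mono[OF s(1)] by simp
  qed (use mem_turing_jump_iff_halts in blast)
  have "computable_from ?Z \<tau>" unfolding \<tau>_def
    by (rule computable_Least[OF _ ex])
      (intro decidable_near_sparse computable_cell_index z computable_intros cf)
  \<comment> \<open>The finitely many arguments below \<open>m + 3\<close>, where the test gives no
    information, are answered from a finite table.\<close>
  then have "decidable_from ?Z (\<lambda>x. if x < m + 3 then x \<in> ?H \<inter> {..<m + 3} else halts x (\<tau> x))"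
    by (intro computable_intros decidable_halts decidable_finite) auto
  moreover have "(if x < m + 3 then x \<in> ?H \<inter> {..<m + 3} else halts x (\<tau> x)) \<longleftrightarrow> x \<in> ?H" for x
    using settled[of x] by simp
  ultimately show ?thesis unfolding turing_computes_iff_decidable_from by simp
qed

theorem theorem3p2:
  fixes z :: real
  assumes "z \<in> {0..1}" and "martin_loef_random z"
  shows "\<not> turing_computes (binary_expansion z) (turing_jump {}) \<longleftrightarrow> positive_density_point z"
  using computes_jump_imp_not_positive_density[OF assms(2,1)]
    not_positive_density_imp_computes_jump[OF assms(2,1)] by blast

end
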